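(* Let $d\in\{2,3\}$ and let $u\in H^1_D(\Omega)$ be the (weak) solution of the diffusion problem $-\nabla\cdot(A\nabla u)=f$ in $\Omega$, $u=0$ on $\Gamma_D$, $-A\nabla u\cdot\mathbf n=g$ on $\Gamma_N$. Then for all $w\in H^1(\mathcal T)$, $$\|A^{1/2}\nabla_h(u-w)\|^2\le \inf_{\boldsymbol\tau\in\Sigma_f(\Omega)}\|A^{-1/2}\boldsymbol\tau+A^{1/2}\nabla_h w\|^2+\inf_{v\in H^1_D(\Omega)}\|A^{1/2}\nabla_h(v-w)\|^2 .$$
   Context: $\Omega\subset\mathbb R^d$, $d\in\{2,3\}$, is a bounded polygonal (polyhedral) domain with Lipschitz boundary $\partial\Omega=\overline\Gamma_D\cup\overline\Gamma_N$, $\overline\Gamma_D\cap\overline\Gamma_N=\emptyset$, $\mathrm{meas}_{d-1}(\Gamma_D)\ne0$; $\mathbf n$ is the outward unit normal. $f\in L^2(\Omega)$, $g\in H^{-1/2}(\Gamma_N)$. $A(x)$ is a symmetric, positive definite full tensor, piecewise constant with respect to $\overline\Omega=\cup_{i=1}^n\overline\Omega_i$, with $\Omega_i$ open and polygonal. $H^1_D(\Omega)=\{v\in H^1(\Omega): v=0 \text{ on }\Gamma_D\}$. The weak solution $u\in H_D^1(\Omega)$ satisfies $(A\nabla u,\nabla v)=(f,v)-\langle g,v\rangle_{\Gamma_N}$ for all $v\in H^1_D(\Omega)$, where $(\cdot,\cdot)$ is the $L^2(\Omega)$ inner product and $\|\cdot\|$ the $L^2(\Omega)$ norm. $\mathcal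 T$ is a regular finite element partition of $\Omega$ such that the interfaces $\partial\Omega_i\cap\partial\Omega_j$ ($i\neq j$) do not cut through any element. $H^1(\mathcal T)=\{v\in L^2(\Omega): v|_K\in H^1(K)\ \forall K\in\mathcal T\}$, and $\nabla_h$ is the discrete gradient: $(\nabla_h v)|_K=\nabla(v|_K)$ for all $K\in\mathcal T$. $H(\mathrm{div};\Omega)$ is the space of $L^2(\Omega)^d$ vector fields with divergence in $L^2(\Omega)$. The equilibrated flux space is $\Sigma_f(\Omega)=\{\boldsymbol\tau\in H(\mathrm{div};\Omega):\nabla\cdot\boldsymbol\tau=f\text{ in }\Omega,\ \boldsymbol\tau\cdot\mathbf n=g\text{ on }\Gamma_N\}$. *)

theory Defs
  imports "HOL-Analysis.Analysis"
begin

section \<open>Geometry\<close>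

text \<open>Straight faces need not be convex, but each is a finite union of convex polytopes.\<close>

definition polygonal :: "(real^'d) set \<Rightarrow> bool" where
  "polygonal S \<longleftrightarrow> open S \<and> bounded S \<and>
     (\<exists>\<F>. finite \<F> \<and> (\<forall>F\<in>\<F>. polytope F \<and> aff_dim F = int CARD('d) - 1) \<and> frontier S = \<Union>\<F>)"

definition polygonal_domain :: "(real^'d) set \<Rightarrow> bool" where
  "polygonal_domain \<Omega> \<longleftrightarrow> polygonal \<Omega> \<and> connected \<Omega> \<and> \<Omega> \<noteq> {}"

text \<open>Near each boundary point, the set is the strict subgraph of a Lipschitz function over a
  hyperplane with unit normal \<open>e\<close>; \<open>(z - x) \<bullet> e\<close> is the height of \<open>z\<close> and
  \<open>(z - x) - ((z - x) \<bullet> e) *\<^sub>R e\<close> its projection to the hyperplane.\<close>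

definition lipschitz_boundary :: "(real^'d) set \<Rightarrow> bool" where
  "lipschitz_boundary \<Omega> \<longleftrightarrow> (\<forall>x\<in>frontier \<Omega>. \<exists>r>0. \<exists>e L \<phi>. norm e = 1 \<and>
     L-lipschitz_on {y. y \<bullet> e = 0} \<phi> \<and>
     \<Omega> \<inter> ball x r = {z \<in> ball x r. (z - x) \<bullet> e < (\<phi> ((z - x) - ((z - x) \<bullet> e) *\<^sub>R e) :: real)})"

text \<open>The elements are closed convex polytopes; simplices and convex quadrilaterals are special
  cases, and conformity is not required.  The last conjunct is shape regularity, the balls
  being inscribed balls of the elements; it also makes every element have nonempty interior.\<close>

definition regular_partition :: "(real^'d) set \<Rightarrow> (real^'d) set set \<Rightarrow> bool" where
  "regular_partition \<Omega> \<T> \<longleftrightarrow> finite \<T> \<and> (\<forall>K\<in>\<T>. polytope K) \<and> \<Union>\<T> = closure \<Omega> \<and>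
     (\<forall>K\<in>\<T>. \<forall>L\<in>\<T>. K \<noteq> L \<longrightarrow> interior K \<inter> interior L = {}) \<and>
     (\<exists>\<kappa>>0. \<forall>K\<in>\<T>. \<exists>c \<rho>. \<rho> > 0 \<and> cball c \<rho> \<subseteq> K \<and> diameter K \<le> \<kappa> * \<rho>)"

text \<open>Hausdorff measure of dimension \<open>s \<ge> 1\<close>, normalized to agree with Lebesgue measure on flat
  pieces.  The case \<open>s = 0\<close> is not intended: there the empty set would get weight 1.\<close>

definition hausdorff_content :: "nat \<Rightarrow> real \<Rightarrow> 'a::metric_space set \<Rightarrow> ennreal" where
  "hausdorff_content s \<delta> S =
     (INF U\<in>{U :: nat \<Rightarrow> 'a set. S \<subseteq> (\<Union>i. U i) \<and> (\<forall>i. bounded (U i) \<and> diameter (U i) \<le> \<delta>)}.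
        \<Sum>i. ennreal (unit_ball_vol (real s) * (diameter (U i) / 2) ^ s))"

definition hausdorff_measure :: "nat \<Rightarrow> 'a::metric_space measure" where
  "hausdorff_measure s =
     measure_of UNIV (sets borel) (\<lambda>S. SUP \<delta>\<in>{0<..}. hausdorff_content s \<delta> S)"

definition surface_measure :: "(real^'d) set \<Rightarrow> (real^'d) measure" where
  "surface_measure \<Omega> = restrict_space (hausdorff_measure (CARD('d) - 1)) (frontier \<Omega>)"


section \<open>Tensors\<close>

definition spd :: "real^'d^'d \<Rightarrow> bool" where
  "spd M \<longleftrightarrow> transpose M = M \<and> (\<forall>x. x \<noteq> 0 \<longrightarrow> x \<bullet> (M *v x) > 0)"

definition mat_sqrt :: "real^'d^'d \<Rightarrow> real^'d^'d" where
  "mat_sqrt M = (THE B. spd B \<and> B ** B = M)"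

abbreviation mat_inv_sqrt :: "real^'d^'d \<Rightarrow> real^'d^'d" where
  "mat_inv_sqrt M \<equiv> matrix_inv (mat_sqrt M)"

text \<open>No condition is imposed on the values of \<open>A\<close> on the interfaces, which are null sets.\<close>

definition piecewise_constant_spd ::
    "(real^'d) set \<Rightarrow> nat \<Rightarrow> (nat \<Rightarrow> (real^'d) set) \<Rightarrow> (real^'d \<Rightarrow> real^'d^'d) \<Rightarrow> bool" where
  "piecewise_constant_spd \<Omega> n \<Omega>s A \<longleftrightarrow>
     (\<forall>i\<in>{1..n}. polygonal (\<Omega>s i)) \<and> closure \<Omega> = (\<Union>i\<in>{1..n}. closure (\<Omega>s i)) \<and>
     (\<forall>i\<in>{1..n}. \<exists>M. spd M \<and> (\<forall>x\<in>\<Omega>s i. A x = M))"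


section \<open>Lebesgue and Sobolev spaces\<close>

text \<open>Elements of all spaces below are functions, not classes modulo equality almost everywhere.\<close>

definition L2 :: "'a measure \<Rightarrow> ('a \<Rightarrow> 'b::real_normed_vector) set" where
  "L2 M = {F \<in> borel_measurable M. integrable M (\<lambda>x. (norm (F x))\<^sup>2)}"

definition norm_L2 :: "'a measure \<Rightarrow> ('a \<Rightarrow> 'b::real_normed_vector) \<Rightarrow> real" where
  "norm_L2 M F = sqrt (LINT x|M. (norm (F x))\<^sup>2)"

definition inner_L2 :: "'a measure \<Rightarrow> ('a \<Rightarrow> 'b::real_inner) \<Rightarrow> ('a \<Rightarrow> 'b) \<Rightarrow> real" where
  "inner_L2 M F G = (LINT x|M. F x \<bullet> G x)"

text \<open>Formulated with the nonnegative integral, since the Bochner integral of a non-integrable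
  function is 0.\<close>

definition converges_L2 ::
    "'a measure \<Rightarrow> (nat \<Rightarrow> 'a \<Rightarrow> 'b::real_normed_vector) \<Rightarrow> ('a \<Rightarrow> 'b) \<Rightarrow> bool" where
  "converges_L2 M F G \<longleftrightarrow> (\<lambda>n. \<integral>\<^sup>+x. ennreal ((norm (F n x - G x))\<^sup>2) \<partial>M) \<longlonglongrightarrow> 0"

primrec Ck :: "nat \<Rightarrow> (real^'d \<Rightarrow> real) \<Rightarrow> bool" where
  "Ck 0 f \<longleftrightarrow> continuous_on UNIV f"
| "Ck (Suc k) f \<longleftrightarrow> (\<exists>g. (\<forall>x. GDERIV f x :> g x) \<and> (\<forall>i. Ck k (\<lambda>x. g x $ i)))"

definition smooth :: "(real^'d \<Rightarrow> real) \<Rightarrow> bool" where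
  "smooth f \<longleftrightarrow> (\<forall>k. Ck k f)"

definition test_function :: "(real^'d) set \<Rightarrow> (real^'d \<Rightarrow> real) \<Rightarrow> bool" where
  "test_function U \<phi> \<longleftrightarrow> smooth \<phi> \<and>
     compact (closure {x. \<phi> x \<noteq> 0}) \<and> closure {x. \<phi> x \<noteq> 0} \<subseteq> U"

definition grad :: "(real^'d \<Rightarrow> real) \<Rightarrow> real^'d \<Rightarrow> real^'d" where
  "grad f x = (\<chi> i. frechet_derivative f (at x) (axis i 1))"

definition is_weak_grad ::
    "(real^'d) set \<Rightarrow> (real^'d \<Rightarrow> real) \<Rightarrow> (real^'d \<Rightarrow> real^'d) \<Rightarrow> bool" where
  "is_weak_grad U v G \<longleftrightarrow> G \<in> L2 (lebesgue_on U) \<and> (\<forall>\<phi>. test_function U \<phi> \<longrightarrow>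
     (LINT x|lebesgue_on U. v x *\<^sub>R grad \<phi> x) = - (LINT x|lebesgue_on U. \<phi> x *\<^sub>R G x))"

definition H1 :: "(real^'d) set \<Rightarrow> (real^'d \<Rightarrow> real) set" where
  "H1 U = {v \<in> L2 (lebesgue_on U). \<exists>G. is_weak_grad U v G}"

text \<open>The weak gradient and the weak divergence below are determined almost everywhere.\<close>

definition weak_grad :: "(real^'d) set \<Rightarrow> (real^'d \<Rightarrow> real) \<Rightarrow> real^'d \<Rightarrow> real^'d" where
  "weak_grad U v = (SOME G. is_weak_grad U v G)"

definition norm_H1 :: "(real^'d) set \<Rightarrow> (real^'d \<Rightarrow> real) \<Rightarrow> real" where
  "norm_H1 U v = sqrt ((norm_L2 (lebesgue_on U) v)\<^sup>2 + (norm_L2 (lebesgue_on U) (weak_grad U v))\<^sup>2)"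

definition is_weak_div ::
    "(real^'d) set \<Rightarrow> (real^'d \<Rightarrow> real^'d) \<Rightarrow> (real^'d \<Rightarrow> real) \<Rightarrow> bool" where
  "is_weak_div U \<tau> q \<longleftrightarrow> q \<in> L2 (lebesgue_on U) \<and> (\<forall>\<phi>. test_function U \<phi> \<longrightarrow>
     inner_L2 (lebesgue_on U) \<tau> (grad \<phi>) = - inner_L2 (lebesgue_on U) q \<phi>)"

definition Hdiv :: "(real^'d) set \<Rightarrow> (real^'d \<Rightarrow> real^'d) set" where
  "Hdiv U = {\<tau> \<in> L2 (lebesgue_on U). \<exists>q. is_weak_div U \<tau> q}"

definition weak_div :: "(real^'d) set \<Rightarrow> (real^'d \<Rightarrow> real^'d) \<Rightarrow> real^'d \<Rightarrow> real" where
  "weak_div U \<tau> = (SOME q. is_weak_div U \<tau> q)"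

definition broken_H1 :: "(real^'d) set \<Rightarrow> (real^'d) set set \<Rightarrow> (real^'d \<Rightarrow> real) set" where
  "broken_H1 \<Omega> \<T> = {v \<in> L2 (lebesgue_on \<Omega>). \<forall>K\<in>\<T>. v \<in> H1 (interior K)}"

text \<open>On each element all but one summand vanishes; on the element boundaries, a null set, the
  value is 0.\<close>

definition broken_grad :: "(real^'d) set set \<Rightarrow> (real^'d \<Rightarrow> real) \<Rightarrow> real^'d \<Rightarrow> real^'d" where
  "broken_grad \<T> v x = (\<Sum>K\<in>\<T>. indicat_real (interior K) x *\<^sub>R weak_grad (interior K) v x)"


section \<open>Traces\<close>

text \<open>The trace operator is the continuous extension of the restriction of smooth functions to
  the boundary, as a map from \<open>H1\<close> to \<open>L2\<close> of the boundary.  It is given here as a relation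
  with its graph.\<close>

definition has_trace :: "(real^'d) set \<Rightarrow> (real^'d \<Rightarrow> real) \<Rightarrow> (real^'d \<Rightarrow> real) \<Rightarrow> bool" where
  "has_trace \<Omega> v \<mu> \<longleftrightarrow> v \<in> H1 \<Omega> \<and> \<mu> \<in> L2 (surface_measure \<Omega>) \<and>
     (\<exists>\<phi>. (\<forall>n. smooth (\<phi> n)) \<and>
        converges_L2 (lebesgue_on \<Omega>) \<phi> v \<and>
        converges_L2 (lebesgue_on \<Omega>) (\<lambda>n. grad (\<phi> n)) (weak_grad \<Omega> v) \<and>
        converges_L2 (surface_measure \<Omega>) \<phi> \<mu>)"

definition H1_zero_on :: "(real^'d) set \<Rightarrow> (real^'d) set \<Rightarrow> (real^'d \<Rightarrow> real) set" where
  "H1_zero_on \<Omega> \<Gamma> =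
     {v \<in> H1 \<Omega>. \<exists>\<mu>. has_trace \<Omega> v \<mu> \<and> (AE x in surface_measure \<Omega>. x \<in> \<Gamma> \<longrightarrow> \<mu> x = 0)}"

definition has_trace_on ::
    "(real^'d) set \<Rightarrow> (real^'d) set \<Rightarrow> (real^'d \<Rightarrow> real) \<Rightarrow> (real^'d \<Rightarrow> real) \<Rightarrow> bool" where
  "has_trace_on \<Omega> \<Gamma> v \<mu> \<longleftrightarrow>
     (\<exists>\<nu>. has_trace \<Omega> v \<nu> \<and> (AE x in surface_measure \<Omega>. x \<in> \<Gamma> \<longrightarrow> \<mu> x = \<nu> x))"

text \<open>\<open>H_half \<Omega> \<Gamma>\<close> is the space of traces on \<open>\<Gamma>\<close> of \<open>H1 \<Omega>\<close> with the quotient norm, and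
  \<open>H_minus_half \<Omega> \<Gamma>\<close> is its dual; \<open>g \<mu>\<close> is the duality pairing.  Functionals in the dual ignore the
  values of \<open>\<mu>\<close> outside \<open>\<Gamma>\<close> and on null sets, as the quotient norm does.\<close>

definition H_half :: "(real^'d) set \<Rightarrow> (real^'d) set \<Rightarrow> (real^'d \<Rightarrow> real) set" where
  "H_half \<Omega> \<Gamma> = {\<mu>. \<exists>v. has_trace_on \<Omega> \<Gamma> v \<mu>}"

definition norm_H_half :: "(real^'d) set \<Rightarrow> (real^'d) set \<Rightarrow> (real^'d \<Rightarrow> real) \<Rightarrow> real" where
  "norm_H_half \<Omega> \<Gamma> \<mu> = (INF v\<in>{v. has_trace_on \<Omega> \<Gamma> v \<mu>}. norm_H1 \<Omega> v)"

definition H_minus_half :: "(real^'d) set \<Rightarrow> (real^'d) set \<Rightarrow> ((real^'d \<Rightarrow> real) \<Rightarrow> real) set" where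
  "H_minus_half \<Omega> \<Gamma> = {g.
     (\<forall>\<mu>\<in>H_half \<Omega> \<Gamma>. \<forall>\<nu>\<in>H_half \<Omega> \<Gamma>. g (\<lambda>x. \<mu> x + \<nu> x) = g \<mu> + g \<nu>) \<and>
     (\<forall>\<mu>\<in>H_half \<Omega> \<Gamma>. \<forall>c. g (\<lambda>x. c * \<mu> x) = c * g \<mu>) \<and>
     (\<exists>C. \<forall>\<mu>\<in>H_half \<Omega> \<Gamma>. \<bar>g \<mu>\<bar> \<le> C * norm_H_half \<Omega> \<Gamma> \<mu>)}"

text \<open>For \<open>\<tau>\<close> in \<open>Hdiv \<Omega>\<close> the normal trace is the functional that Green's formula defines on the
  traces of \<open>H1 \<Omega>\<close>.\<close>

definition normal_trace :: "(real^'d) set \<Rightarrow> (real^'d \<Rightarrow> real^'d) \<Rightarrow> (real^'d \<Rightarrow> real) \<Rightarrow> real" where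
  "normal_trace \<Omega> \<tau> v =
     inner_L2 (lebesgue_on \<Omega>) \<tau> (weak_grad \<Omega> v) + inner_L2 (lebesgue_on \<Omega>) (weak_div \<Omega> \<tau>) v"

text \<open>Equality on the Neumann part \<open>\<Gamma>N\<close>, as functionals on the traces of functions that vanish on
  the complementary part \<open>\<Gamma>D\<close>: the values of such a trace on the whole boundary are those on \<open>\<Gamma>N\<close>,
  extended by 0.\<close>

definition normal_trace_eq_on ::
    "(real^'d) set \<Rightarrow> (real^'d) set \<Rightarrow> (real^'d \<Rightarrow> real^'d) \<Rightarrow> ((real^'d \<Rightarrow> real) \<Rightarrow> real) \<Rightarrow> bool" where
  "normal_trace_eq_on \<Omega> \<Gamma>D \<tau> g \<longleftrightarrow>
     (\<forall>v\<in>H1_zero_on \<Omega> \<Gamma>D. \<forall>\<mu>. has_trace \<Omega> v \<mu> \<longrightarrow> normal_trace \<Omega> \<tau> v = g \<mu>)"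


section \<open>The diffusion problem\<close>

definition weak_solution ::
    "(real^'d) set \<Rightarrow> (real^'d) set \<Rightarrow> (real^'d \<Rightarrow> real^'d^'d) \<Rightarrow> (real^'d \<Rightarrow> real) \<Rightarrow>
     ((real^'d \<Rightarrow> real) \<Rightarrow> real) \<Rightarrow> (real^'d \<Rightarrow> real) \<Rightarrow> bool" where
  "weak_solution \<Omega> \<Gamma>D A f g u \<longleftrightarrow> u \<in> H1_zero_on \<Omega> \<Gamma>D \<and>
     (\<forall>v\<in>H1_zero_on \<Omega> \<Gamma>D. \<forall>\<mu>. has_trace \<Omega> v \<mu> \<longrightarrow>
        inner_L2 (lebesgue_on \<Omega>) (\<lambda>x. A x *v weak_grad \<Omega> u x) (weak_grad \<Omega> v) =
        inner_L2 (lebesgue_on \<Omega>) f v - g \<mu>)"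

definition equilibrated_fluxes ::
    "(real^'d) set \<Rightarrow> (real^'d) set \<Rightarrow> (real^'d \<Rightarrow> real) \<Rightarrow> ((real^'d \<Rightarrow> real) \<Rightarrow> real) \<Rightarrow>
     (real^'d \<Rightarrow> real^'d) set" where
  "equilibrated_fluxes \<Omega> \<Gamma>D f g =
     {\<tau> \<in> Hdiv \<Omega>. (AE x in lebesgue_on \<Omega>. weak_div \<Omega> \<tau> x = f x) \<and> normal_trace_eq_on \<Omega> \<Gamma>D \<tau> g}"

end

theory Submission
  imports Defs
begin

text \<open>Write \<open>p\<close> for the broken gradient of \<open>w\<close> and measure vector fields in the inner product weighted by
  \<open>A\<close>.  For an equilibrated flux \<open>\<tau>\<close>, both \<open>\<tau>\<close> and \<open>- A \<nabla>u\<close> have divergence \<open>f\<close> and the same Neumann data,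
  so \<open>\<sigma> = - A\<^sup>-\<^sup>1 \<tau>\<close> satisfies the Prager-Synge relation: \<open>\<nabla>u - \<sigma>\<close> is orthogonal to \<open>\<nabla>v\<close> for every \<open>v\<close> that vanishes on
  \<open>\<Gamma>D\<close> (\<open>flux_difference_orthogonal\<close>).  For each such \<open>v\<close>, with \<open>e = \<nabla>u - \<nabla>v\<close>,
  \<open>\<parallel>\<nabla>u - p\<parallel>\<^sup>2 - \<parallel>\<nabla>v - p\<parallel>\<^sup>2 = 2 \<langle>e, \<nabla>u - p\<rangle> - \<parallel>e\<parallel>\<^sup>2 = 2 \<langle>e, \<sigma> - p\<rangle> - \<parallel>e\<parallel>\<^sup>2 \<le> \<parallel>\<sigma> - p\<parallel>\<^sup>2\<close>,
  and \<open>\<parallel>\<sigma> - p\<parallel>\<close> is the norm of \<open>A\<^bsup>-1/2\<^esup> \<tau> + A\<^bsup>1/2\<^esup> p\<close>.  Thus the bound holds for every single pair of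
  \<open>\<tau>\<close> and \<open>v\<close> (\<open>error_estimate\<close>), and it remains to take infima over nonempty sets, with \<open>- A \<nabla>u\<close> as
  one of the fluxes (\<open>solution_flux_equilibrated\<close>).

  This argument is about classes of functions modulo null sets, whereas weak gradients and divergences
  are here chosen representatives.  What makes it work for them is uniqueness almost everywhere, from the
  fundamental lemma of the calculus of variations (\<open>fundamental_lemma_variations\<close>); it rests on explicit smooth bump
  functions.  It gives the compatibility of broken and global gradients
  (\<open>broken_grad_diff\<close>), where the Lipschitz boundary ensures that the elements have their interior in \<open>\<Omega>\<close>.
  Interior test functions are admissible in the weak form because their classical gradient
  is a weak one, by integration by parts (\<open>integration_by_parts\<close>).  Finally, \<open>mat_sqrt\<close> is meaningful because
  a positive definite matrix has exactly one positive definite square root (\<open>spd_square_root_exists\<close>,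
  \<open>spd_square_root_unique\<close>).\<close>

section \<open>Smooth functions\<close>

lemma GDERIV_continuous_on:
  assumes "\<And>x. GDERIV f x :> g x"
  shows "continuous_on UNIV (f :: 'a::real_inner \<Rightarrow> real)"
proof -
  have "isCont f x" for x
    using assms[of x] unfolding gderiv_def by (rule has_derivative_continuous)
  then show ?thesis by (simp add: continuous_at_imp_continuous_on)
qed

lemma Ck_continuous: "Ck k f \<Longrightarrow> continuous_on UNIV f"
  by (cases k) (auto intro: GDERIV_continuous_on)

lemma Ck_Suc_imp_Ck: "Ck (Suc k) f \<Longrightarrow> Ck k f"
proof (induction k arbitrary: f)
  case 0
  then show ?case using Ck_continuous[of "Suc 0" f] by simp
next
  case (Suc k)
  then obtain g where "\<forall>x. GDERIV f x :> g x" "\<forall>i. Ck (Suc k) (\<lambda>x. g x $ i)"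
    by (subst (asm) Ck.simps(2)) auto
  with Suc.IH show ?case by auto
qed

lemma Ck_const: "Ck k (\<lambda>_. c)"
proof (induction k arbitrary: c)
  case (Suc k)
  have "\<forall>x. GDERIV (\<lambda>_. c) (x::real^'a) :> 0" by (simp add: GDERIV_const)
  with Suc.IH[of 0] show ?case by (auto intro!: exI[of _ "\<lambda>_. 0"])
qed simp

lemma Ck_add: "Ck k f \<Longrightarrow> Ck k g \<Longrightarrow> Ck k (\<lambda>x. f x + g x)"
proof (induction k arbitrary: f g)
  case 0
  then show ?case by (auto intro: continuous_intros)
next
  case (Suc k)
  then obtain df dg where "\<forall>x. GDERIV f x :> df x" "\<forall>i. Ck k (\<lambda>x. df x $ i)"
    "\<forall>x. GDERIV g x :> dg x" "\<forall>i. Ck k (\<lambda>x. dg x $ i)" by auto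
  then show ?case
    by (auto intro!: exI[of _ "\<lambda>x. df x + dg x"] GDERIV_add Suc.IH)
qed

lemma Ck_mult: "Ck k f \<Longrightarrow> Ck k g \<Longrightarrow> Ck k (\<lambda>x. f x * g x)"
proof (induction k arbitrary: f g)
  case 0
  then show ?case by (auto intro: continuous_intros)
next
  case (Suc k)
  note low = Suc.prems[THEN Ck_Suc_imp_Ck]
  from Suc.prems obtain df dg where "\<forall>x. GDERIV f x :> df x" "\<forall>i. Ck k (\<lambda>x. df x $ i)"
    "\<forall>x. GDERIV g x :> dg x" "\<forall>i. Ck k (\<lambda>x. dg x $ i)" by auto
  then show ?case using low
    by (auto intro!: exI[of _ "\<lambda>x. f x *\<^sub>R dg x + g x *\<^sub>R df x"] GDERIV_mult Suc.IH Ck_add)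
qed

lemma Ck_prod: "(\<And>i. i \<in> I \<Longrightarrow> Ck k (f i)) \<Longrightarrow> Ck k (\<lambda>x. \<Prod>i\<in>I. f i x)"
  by (induction I rule: infinite_finite_induct) (auto intro: Ck_const Ck_mult)

text \<open>Smooth functions of one affine coordinate: the gradient is the derivative times a fixed
  vector, so the induction runs along the sequence \<open>F\<close> of iterated derivatives.\<close>

lemma Ck_compose_coordinate:
  assumes "\<And>m t. (F m has_real_derivative F (Suc m) t) (at t)"
  shows "Ck k (\<lambda>x::real^'d. F m (c * (x $ i) + d))"
proof (induction k arbitrary: m)
  case 0
  have "continuous_on UNIV (F m)"
    using assms by (meson DERIV_isCont continuous_at_imp_continuous_on)
  then have "continuous_on UNIV (\<lambda>x::real^'d. F m (c * (x $ i) + d))"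
    by (rule continuous_on_compose2) (auto intro!: continuous_intros)
  then show ?case by simp
next
  case (Suc k)
  have "GDERIV (\<lambda>x::real^'d. F m (c * (x $ i) + d)) x :>
      F (Suc m) (c * (x $ i) + d) *\<^sub>R (c *\<^sub>R axis i 1)" for x
    by (rule GDERIV_DERIV_compose[OF _ assms])
      (auto simp: gderiv_def inner_axis bounded_linear_vec_nth
        intro!: derivative_eq_intros bounded_linear_imp_has_derivative)
  moreover have "Ck k (\<lambda>x::real^'d. (F (Suc m) (c * (x $ i) + d) *\<^sub>R (c *\<^sub>R axis i 1)) $ j)" for j
    using Ck_mult[OF Suc.IH[of "Suc m"] Ck_const[of k "c * (axis i 1 :: real^'d) $ j"]]
    by (simp add: mult.assoc)
  ultimately show ?case
    unfolding Ck.simps(2)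
    by (intro exI[of _ "\<lambda>x. F (Suc m) (c * (x $ i) + d) *\<^sub>R (c *\<^sub>R axis i 1)"]) auto
qed

text \<open>The functions \<open>p (1/t) exp (-1/t)\<close>, extended by 0 to \<open>t \<le> 0\<close>, are closed under
  differentiation: with \<open>s = 1/t\<close> the derivative is \<open>s\<^sup>2 (p s - p' s) exp (-s)\<close>.\<close>

definition flat_exp :: "real poly \<Rightarrow> real \<Rightarrow> real" where
  "flat_exp p t = (if t > 0 then poly p (1 / t) * exp (- (1 / t)) else 0)"

definition flat_exp_deriv :: "real poly \<Rightarrow> real poly" where
  "flat_exp_deriv p = [:0, 0, 1:] * (p - pderiv p)"

lemma poly_times_exp_minus_at_top: "((\<lambda>s. poly p s * exp (- s)) \<longlongrightarrow> (0::real)) at_top"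
proof -
  have "((\<lambda>s. \<Sum>i\<le>degree p. coeff p i * (s ^ i / exp s)) \<longlongrightarrow> (\<Sum>i\<le>degree p. coeff p i * 0)) at_top"
    by (intro tendsto_sum tendsto_mult tendsto_const tendsto_power_div_exp_0)
  then show ?thesis
    by (simp add: poly_altdef sum_distrib_right exp_minus divide_inverse mult.assoc)
qed

lemma flat_exp_tendsto_0: "(flat_exp p \<longlongrightarrow> 0) (at 0)"
proof -
  have "((\<lambda>t. poly p (inverse t) * exp (- inverse t)) \<longlongrightarrow> 0) (at_right 0)"
    by (rule filterlim_compose[OF poly_times_exp_minus_at_top filterlim_inverse_at_top_right])
  then have r: "(flat_exp p \<longlongrightarrow> 0) (at_right 0)"
    by (rule Lim_transform_eventually)
      (auto simp: flat_exp_def eventually_at_filter inverse_eq_divide)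
  have l: "(flat_exp p \<longlongrightarrow> 0) (at_left 0)"
    by (rule Lim_transform_eventually[OF tendsto_const])
      (auto simp: flat_exp_def eventually_at_filter)
  show ?thesis using filterlim_split_at[OF l r] .
qed

lemma has_derivative_flat_exp:
  "(flat_exp p has_real_derivative flat_exp (flat_exp_deriv p) t) (at t)"
proof -
  consider "t > 0" | "t < 0" | "t = 0" by linarith
  then show ?thesis
  proof cases
    case 1
    have "((\<lambda>t. poly p (1 / t) * exp (- (1 / t))) has_real_derivative
        flat_exp (flat_exp_deriv p) t) (at t)"
      using 1
      by (auto intro!: derivative_eq_intros poly_DERIV[THEN DERIV_chain2]
          simp: flat_exp_def flat_exp_deriv_def field_simps power2_eq_square)
    then show ?thesis
      by (rule has_field_derivative_transform_within_open[of _ _ _ "{0<..}"])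
        (use 1 in \<open>auto simp: flat_exp_def\<close>)
  next
    case 2
    have "((\<lambda>t. 0) has_real_derivative flat_exp (flat_exp_deriv p) t) (at t)"
      using 2 by (auto simp: flat_exp_def)
    then show ?thesis
      by (rule has_field_derivative_transform_within_open[of _ _ _ "{..<0}"])
        (use 2 in \<open>auto simp: flat_exp_def\<close>)
  next
    case 3
    \<comment> \<open>the difference quotient at 0 is again of this form, with an additional factor \<open>1/t\<close>\<close>
    have "((\<lambda>h. flat_exp p h / h) \<longlongrightarrow> 0) (at 0)"
      by (rule Lim_transform_eventually[OF flat_exp_tendsto_0[of "[:0, 1:] * p"]])
        (auto simp: flat_exp_def eventually_at_filter)
    then show ?thesis
      using 3 by (simp add: DERIV_def flat_exp_def)
  qed
qed

lemma Ck_flat_exp_coordinate: "Ck k (\<lambda>x::real^'d. flat_exp p (c * (x $ i) + d))"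
  using Ck_compose_coordinate[of "\<lambda>m. flat_exp ((flat_exp_deriv ^^ m) p)" k 0 c i d]
  by (simp add: has_derivative_flat_exp)

text \<open>Since \<open>flat_exp 1 (k t) = exp (-1/(k t))\<close> tends to 1 for every \<open>t > 0\<close>, rescaling one bump function
  of a box yields smooth functions that converge to the indicator of the box.\<close>

definition box_bump :: "nat \<Rightarrow> real^'d \<Rightarrow> real^'d \<Rightarrow> real^'d \<Rightarrow> real" where
  "box_bump k a b x =
     (\<Prod>i\<in>UNIV. flat_exp 1 (real (Suc k) * (x $ i - a $ i)) * flat_exp 1 (real (Suc k) * (b $ i - x $ i)))"

lemma smooth_box_bump: "smooth (box_bump k a b)"
proof -
  have "Ck m (\<lambda>x. flat_exp 1 (real (Suc k) * (x $ i - a $ i)) * flat_exp 1 (real (Suc k) * (b $ i - x $ i)))"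
    for m and i :: 'a
    using Ck_mult[OF Ck_flat_exp_coordinate[of m 1 "real (Suc k)" i "- real (Suc k) * a $ i"]
        Ck_flat_exp_coordinate[of m 1 "- real (Suc k)" i "real (Suc k) * b $ i"]]
    by (simp add: algebra_simps)
  then show ?thesis
    unfolding smooth_def box_bump_def by (auto intro!: Ck_prod)
qed

lemma flat_exp_one_bounds: "0 \<le> flat_exp 1 t" "flat_exp 1 t \<le> 1"
  by (auto simp: flat_exp_def)

lemma box_bump_bounds: "0 \<le> box_bump k a b x" "box_bump k a b x \<le> 1"
proof -
  have *: "0 \<le> flat_exp 1 s * flat_exp 1 t \<and> flat_exp 1 s * flat_exp 1 t \<le> 1" for s t
    using flat_exp_one_bounds[of s] flat_exp_one_bounds[of t] by (simp add: mult_le_one)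
  show "0 \<le> box_bump k a b x"
    unfolding box_bump_def by (rule prod_nonneg) (use * in blast)
  show "box_bump k a b x \<le> 1"
    unfolding box_bump_def by (rule prod_le_1) (use * in blast)
qed

lemma box_bump_eq_0: "x \<notin> box a b \<Longrightarrow> box_bump k a b x = 0"
proof -
  assume "x \<notin> box a b"
  then obtain i where "x $ i - a $ i \<le> 0 \<or> b $ i - x $ i \<le> 0"
    by (auto simp: mem_box_cart not_less)
  then have "flat_exp 1 (real (Suc k) * (x $ i - a $ i)) * flat_exp 1 (real (Suc k) * (b $ i - x $ i)) = 0"
    by (auto simp: flat_exp_def zero_less_mult_iff simp del: of_nat_Suc)
  then show ?thesis
    unfolding box_bump_def by (intro prod_zero) auto
qed

lemma flat_exp_rescaled_tendsto_1:
  assumes "t > 0"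
  shows "(\<lambda>k. flat_exp 1 (real (Suc k) * t)) \<longlonglongrightarrow> 1"
proof -
  have "(\<lambda>k. inverse (real (Suc k)) * inverse t) \<longlonglongrightarrow> 0 * inverse t"
    by (intro tendsto_mult LIMSEQ_inverse_real_of_nat tendsto_const)
  then have "(\<lambda>k. exp (- (inverse (real (Suc k)) * inverse t))) \<longlonglongrightarrow> exp (- 0)"
    by (intro tendsto_intros) simp
  then show ?thesis
    using assms by (simp add: flat_exp_def zero_less_mult_iff inverse_eq_divide del: of_nat_Suc)
qed

lemma box_bump_tendsto: "(\<lambda>k. box_bump k a b x) \<longlonglongrightarrow> indicat_real (box a b) x"
proof (cases "x \<in> box a b")
  case True
  then have "x $ i - a $ i > 0" "b $ i - x $ i > 0" for i
    by (auto simp: mem_box_cart)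
  then have "(\<lambda>k. box_bump k a b x) \<longlonglongrightarrow> (\<Prod>i\<in>(UNIV::'a set). 1 * 1)"
    unfolding box_bump_def by (intro tendsto_prod tendsto_mult flat_exp_rescaled_tendsto_1) auto
  then show ?thesis using True by simp
qed (simp add: box_bump_eq_0)

lemma test_function_box_bump:
  assumes "cbox a b \<subseteq> U"
  shows "test_function U (box_bump k a b)"
proof -
  have "{x. box_bump k a b x \<noteq> 0} \<subseteq> cbox a b"
    using box_bump_eq_0 box_subset_cbox by blast
  then have *: "closure {x. box_bump k a b x \<noteq> 0} \<subseteq> cbox a b"
    by (rule closure_minimal) (rule closed_cbox)
  then have "compact (closure {x. box_bump k a b x \<noteq> 0})"
    by (meson bounded_cbox bounded_subset closed_closure compact_eq_bounded_closed)
  with * assms show ?thesis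
    unfolding test_function_def using smooth_box_bump by auto
qed


section \<open>The fundamental lemma of the calculus of variations\<close>

text \<open>The sets over which \<open>h\<close> integrates to 0 form a Dynkin system, so with the boxes they include all
  Borel sets; a Lebesgue set differs from a Borel set by a null set.\<close>

lemma AE_eq_0_if_box_integrals_eq_0:
  fixes h :: "'a::euclidean_space \<Rightarrow> real"
  assumes h: "integrable lebesgue h"
    and zero: "\<And>a b. (LINT x:box a b|lebesgue. h x) = 0"
  shows "AE x in lebesgue. h x = 0"
proof (rule density_unique_real[OF h, of "\<lambda>_. 0"])
  have int: "set_integrable lebesgue A h" if "A \<in> sets lebesgue" for A
    using integrable_mult_indicator[OF that h] by (simp add: set_integrable_def)
  have E: "Int_stable (range (\<lambda>(a, b). box a b :: 'a set))"
    by (auto simp: Int_stable_def box_Int_box)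
  have sb: "A \<in> sigma_sets UNIV (range (\<lambda>(a, b). box a b :: 'a set)) \<Longrightarrow> A \<in> sets lebesgue" for A
    using sets_completionI_sets[of A lborel] by (simp add: borel_eq_box)
  have total: "(LINT x|lebesgue. h x) = 0"
  proof -
    let ?B = "\<lambda>n::nat. box (- real n *\<^sub>R One) (real n *\<^sub>R One) :: 'a set"
    have "(\<lambda>n. LINT x:?B n|lebesgue. h x) \<longlonglongrightarrow> (LINT x:(\<Union>n. ?B n)|lebesgue. h x)"
    proof (rule set_integral_cont_up)
      show "incseq ?B"
        by (intro monoI) (auto simp: mem_box, (smt (verit) of_nat_mono)+)
      show "set_integrable lebesgue (\<Union>n. ?B n) h"
        by (rule int) auto
    qed auto
    moreover have "(\<Union>n. ?B n) = UNIV" using UN_box_eq_UNIV by simp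
    ultimately show ?thesis
      by (simp only: zero LIMSEQ_const_iff) (simp add: set_lebesgue_integral_def)
  qed
  have borel: "(LINT x:A|lebesgue. h x) = 0" if "A \<in> sets borel" for A
  proof -
    have A: "A \<in> sigma_sets UNIV (range (\<lambda>(a, b). box a b :: 'a set))"
      using that unfolding borel_eq_box by simp
    have "range (\<lambda>(a, b). box a b :: 'a set) \<subseteq> Pow UNIV" by simp
    from E this A show ?thesis
    proof (induction rule: sigma_sets_induct_disjoint)
      case (basic A)
      then show ?case using zero by auto
    next
      case empty
      show ?case by (simp add: set_lebesgue_integral_def)
    next
      case (compl A)
      then have A: "A \<in> sets lebesgue" by (simp add: sb)
      have "(LINT x:A \<union> (UNIV - A)|lebesgue. h x) = (LINT x:A|lebesgue. h x) + (LINT x:UNIV - A|lebesgue. h x)"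
        using A by (intro set_integral_Un int) auto
      then show ?case using compl total by (simp add: set_lebesgue_integral_def)
    next
      case (union A)
      then have A: "A i \<in> sets lebesgue" for i by (auto intro: sb)
      have "(LINT x:(\<Union>i. A i)|lebesgue. h x) = (\<Sum>i. (LINT x:A i|lebesgue. h x))"
        using A union by (intro lebesgue_integral_countable_add int) (auto simp: disjoint_family_on_def)
      then show ?case using union by simp
    qed
  qed
  fix A :: "'a set" assume A: "A \<in> sets lebesgue"
  then have "(LINT x:A|lebesgue. h x) = (LINT x:main_part lborel A|lebesgue. h x)"
  proof (intro set_integral_cong_set)
    show "AE x in lebesgue. (x \<in> main_part lborel A) = (x \<in> A)"
    proof (rule AE_I')
      show "null_part lborel A \<in> null_sets lebesgue"
        using null_part_null_sets[of A lborel] A by (simp add: null_sets_completionI)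
      show "{x \<in> space lebesgue. \<not> ((x \<in> main_part lborel A) = (x \<in> A))} \<subseteq> null_part lborel A"
        using main_part_null_part_Un[OF A] by blast
    qed
    show "set_borel_measurable lebesgue A h" "set_borel_measurable lebesgue (main_part lborel A) h"
      unfolding set_borel_measurable_def using h A sets_completionI_sets[OF main_part_sets[OF A]]
      by (intro borel_measurable_scaleR borel_measurable_indicator borel_measurable_integrable; simp)+
  qed
  then show "(LINT x:A|lebesgue. h x) = (LINT x:A|lebesgue. 0)"
    using borel[of "main_part lborel A"] main_part_sets[OF A] by simp
qed simp


lemma integrable_lebesgue_on_iff:
  "U \<in> sets lebesgue \<Longrightarrow>
    integrable (lebesgue_on U) h \<longleftrightarrow> integrable lebesgue (\<lambda>x. indicat_real U x *\<^sub>R (h x :: 'b::{banach, second_countable_topology}))"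
  by (subst integrable_restrict_space) auto

lemma integral_lebesgue_on:
  "U \<in> sets lebesgue \<Longrightarrow>
    (LINT x|lebesgue_on U. h x) = (LINT x|lebesgue. indicat_real U x *\<^sub>R (h x :: 'b::{banach, second_countable_topology}))"
  by (subst integral_restrict_space) auto

text \<open>The bumps turn the hypothesis into vanishing integrals over boxes inside \<open>U\<close>.  Countably many
  boxes cover \<open>U\<close>, and within each of them the sub-boxes determine the function.\<close>

lemma fundamental_lemma_variations:
  fixes h :: "real^'d \<Rightarrow> real"
  assumes U: "open U" and h: "integrable (lebesgue_on U) h"
    and zero: "\<And>\<phi>. test_function U \<phi> \<Longrightarrow> (LINT x|lebesgue_on U. \<phi> x * h x) = 0"
  shows "AE x in lebesgue_on U. h x = 0"
proof -
  have Us: "U \<in> sets lebesgue" using U by auto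
  define H where "H x = indicat_real U x * h x" for x
  have H: "integrable lebesgue H"
    using h Us unfolding H_def by (simp add: integrable_lebesgue_on_iff)
  have box0: "(LINT x:box a b|lebesgue. H x) = 0" if ab: "cbox a b \<subseteq> U" for a b
  proof -
    have "(\<lambda>k. LINT x|lebesgue. box_bump k a b x * H x) \<longlonglongrightarrow> (LINT x|lebesgue. indicat_real (box a b) x * H x)"
    proof (rule integral_dominated_convergence[where w = "\<lambda>x. \<bar>H x\<bar>"])
      show "(\<lambda>x. indicat_real (box a b) x * H x) \<in> borel_measurable lebesgue"
        using H by (intro borel_measurable_times borel_measurable_indicator) auto
      show "(\<lambda>x. box_bump k a b x * H x) \<in> borel_measurable lebesgue" for k
      proof (intro borel_measurable_times)
        have "continuous_on UNIV (box_bump k a b)"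
          using smooth_box_bump Ck_continuous unfolding smooth_def by blast
        then show "box_bump k a b \<in> borel_measurable lebesgue"
          by (intro measurable_completion) (simp add: borel_measurable_continuous_onI)
      qed (use H in auto)
      show "AE x in lebesgue. (\<lambda>k. box_bump k a b x * H x) \<longlonglongrightarrow> indicat_real (box a b) x * H x"
        by (intro AE_I2 tendsto_mult box_bump_tendsto tendsto_const)
      show "AE x in lebesgue. norm (box_bump k a b x * H x) \<le> \<bar>H x\<bar>" for k
        by (intro AE_I2) (simp add: abs_mult abs_of_nonneg box_bump_bounds mult_left_le_one_le)
    qed (use H in auto)
    moreover have "(LINT x|lebesgue. box_bump k a b x * H x) = 0" for k
      using zero[OF test_function_box_bump[OF ab, of k]] Us
      by (simp add: integral_lebesgue_on H_def mult.left_commute)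
    ultimately show ?thesis
      by (simp add: LIMSEQ_const_iff set_lebesgue_integral_def)
  qed
  have AEbox: "AE x in lebesgue. x \<in> cbox c d \<longrightarrow> h x = 0" if cd: "cbox c d \<subseteq> U" for c d
  proof -
    have "AE x in lebesgue. indicat_real (box c d) x * H x = 0"
    proof (rule AE_eq_0_if_box_integrals_eq_0)
      show "integrable lebesgue (\<lambda>x. indicat_real (box c d) x * H x)"
        using integrable_mult_indicator[OF _ H, of "box c d"] by simp
      fix a b :: "real^'d"
      obtain e f where ef: "box a b \<inter> box c d = box e f"
        using box_Int_box by blast
      have "(LINT x:box a b|lebesgue. indicat_real (box c d) x * H x) = (LINT x:box e f|lebesgue. H x)"
        unfolding set_lebesgue_integral_def ef[symmetric] by (simp add: indicator_inter_arith mult.assoc)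
      also have "\<dots> = 0"
      proof (cases "box e f = {}")
        case False
        have "closure (box e f) \<subseteq> closure (box c d)"
          using ef by (intro closure_mono) blast
        then have "cbox e f \<subseteq> U"
          using False cd ef by (metis closure_box inf_bot_right order_trans)
        then show ?thesis by (rule box0)
      qed (simp add: set_lebesgue_integral_def)
      finally show "(LINT x:box a b|lebesgue. indicat_real (box c d) x * H x) = 0" .
    qed
    moreover have "AE x in lebesgue. x \<notin> cbox c d - box c d"
      by (intro AE_not_in) (use negligible_frontier_interval negligible_iff_null_sets in blast)
    ultimately show ?thesis
    proof eventually_elim
      case (elim x)
      then show ?case using cd by (auto simp: H_def indicator_def split: if_splits)
    qed
  qed
  obtain \<D> where \<D>: "countable \<D>" "\<And>X. X \<in> \<D> \<Longrightarrow> \<exists>a b. X = cbox a b" "\<Union>\<D> = U"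
    using open_countable_Union_open_cbox[OF U] by metis
  have "AE x in lebesgue. \<forall>X\<in>\<D>. x \<in> X \<longrightarrow> h x = 0"
  proof (subst AE_ball_countable[OF \<D>(1)], intro ballI)
    fix X assume X: "X \<in> \<D>"
    then obtain a b where "X = cbox a b" using \<D> by blast
    then show "AE x in lebesgue. x \<in> X \<longrightarrow> h x = 0"
      using AEbox[of a b] X \<D>(3) by blast
  qed
  then have "AE x in lebesgue. x \<in> U \<longrightarrow> h x = 0"
    using \<D>(3) by (auto elim!: eventually_mono)
  then show ?thesis
    using Us by (simp add: AE_restrict_space_iff)
qed


section \<open>Integration by parts\<close>

text \<open>By translation invariance every difference quotient integrates to 0; they converge to the
  derivative, dominated by the Lipschitz constant on a fixed ball.\<close>

lemma integral_directional_derivative_eq_0: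
  fixes F :: "'a::euclidean_space \<Rightarrow> real"
  assumes F: "\<And>x. GDERIV F x :> G x" and G: "continuous_on UNIV G"
    and S: "compact S" and F0: "\<And>x. x \<notin> S \<Longrightarrow> F x = 0" and G0: "\<And>x. x \<notin> S \<Longrightarrow> G x = 0"
  shows "(LINT x|lborel. G x \<bullet> e) = 0"
proof -
  have contF: "continuous_on UNIV F" by (rule GDERIV_continuous_on[OF F])
  then have F_meas[measurable]: "F \<in> borel_measurable borel"
    by (rule borel_measurable_continuous_onI)
  have G_meas[measurable]: "G \<in> borel_measurable borel"
    using G by (rule borel_measurable_continuous_onI)
  obtain r where r: "S \<subseteq> cball 0 r"
    using compact_imp_bounded[OF S] by (metis bounded_iff dist_0_norm mem_cball subsetI)
  obtain C where C: "\<And>x. norm (G x) \<le> C"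
  proof -
    have "compact (G ` S)" using S G by (meson compact_continuous_image continuous_on_subset subset_UNIV)
    then obtain C where "\<forall>y\<in>G ` S. norm y \<le> C" by (meson bounded_iff compact_imp_bounded)
    then have "norm (G x) \<le> max C 0" for x by (cases "x \<in> S") (auto simp: G0 intro: le_max_iff_disj[THEN iffD2])
    then show ?thesis using that by blast
  qed
  then have C0: "C \<ge> 0" using norm_ge_zero order_trans by blast
  have lip: "\<bar>F y - F x\<bar> \<le> C * norm (y - x)" for x y
  proof -
    have "norm (F y - F x) \<le> C * norm (y - x)"
    proof (rule differentiable_bound[of UNIV F "\<lambda>x h. h \<bullet> G x"])
      show "(F has_derivative (\<lambda>h. h \<bullet> G x)) (at x within UNIV)" for x
        using F[of x] unfolding gderiv_def by simp
      show "onorm (\<lambda>h. h \<bullet> G x) \<le> C" for x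
      proof (rule onorm_bound[OF C0])
        fix h show "norm (h \<bullet> G x) \<le> C * norm h"
          using Cauchy_Schwarz_ineq2[of h "G x"] mult_left_mono[OF C[of x] norm_ge_zero[of h]]
          by (simp add: mult.commute)
      qed
    qed auto
    then show ?thesis by simp
  qed
  define s where "s n = inverse (real (Suc n))" for n
  have s: "s n > 0" "s n \<le> 1" for n by (auto simp: s_def inverse_le_1_iff)
  have s0: "s \<longlonglongrightarrow> 0" unfolding s_def by (rule LIMSEQ_inverse_real_of_nat)
  define D where "D n x = (F (x + s n *\<^sub>R e) - F x) / s n" for n x
  have F_int: "integrable lborel F"
  proof -
    have "integrable lborel (\<lambda>x. indicator S x *\<^sub>R F x)"
      using borel_integrable_compact[OF S continuous_on_subset[OF contF]] by auto
    also have "(\<lambda>x. indicator S x *\<^sub>R F x) = F" using F0 by (fastforce simp: indicator_def)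
    finally show ?thesis .
  qed
  have shift: "integrable lborel (\<lambda>x. F (x + v))" "(LINT x|lborel. F (x + v)) = (LINT x|lborel. F x)" for v
  proof -
    have "integrable (distr lborel borel ((+) v)) F" using F_int by (simp add: lborel_distr_plus)
    then show "integrable lborel (\<lambda>x. F (x + v))" by (subst (asm) integrable_distr_eq) (auto simp: add.commute)
    have "(LINT x|distr lborel borel ((+) v). F x) = (LINT x|lborel. F (v + x))"
      by (rule integral_distr) auto
    then show "(LINT x|lborel. F (x + v)) = (LINT x|lborel. F x)"
      by (simp add: lborel_distr_plus add.commute)
  qed
  have D_zero: "(LINT x|lborel. D n x) = 0" for n
    unfolding D_def using shift F_int by simp
  have "(\<lambda>n. LINT x|lborel. D n x) \<longlonglongrightarrow> (LINT x|lborel. G x \<bullet> e)"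
  proof (rule integral_dominated_convergence[where w = "\<lambda>x. indicator (cball 0 (r + norm e)) x *\<^sub>R (C * norm e)"])
    show "integrable lborel (\<lambda>x. indicator (cball 0 (r + norm e)) x *\<^sub>R (C * norm e))"
      by (intro borel_integrable_compact) auto
    show "AE x in lborel. (\<lambda>n. D n x) \<longlonglongrightarrow> G x \<bullet> e"
    proof (rule AE_I2)
      fix x
      have "((\<lambda>t. F (x + t *\<^sub>R e)) has_derivative (\<lambda>t. (t *\<^sub>R e) \<bullet> G x)) (at 0)"
        by (rule has_derivative_compose[of "\<lambda>t. x + t *\<^sub>R e" "\<lambda>t. t *\<^sub>R e" _ _ F])
          (use F[of x] in \<open>auto intro!: derivative_eq_intros simp: gderiv_def\<close>)
      then have "((\<lambda>t. F (x + t *\<^sub>R e)) has_real_derivative (e \<bullet> G x)) (at 0)"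
        by (simp add: has_field_derivative_def mult_commute_abs)
      then have "((\<lambda>t. (F (x + t *\<^sub>R e) - F x) / t) \<longlongrightarrow> e \<bullet> G x) (at 0)"
        by (simp add: DERIV_def)
      moreover have "filterlim s (at 0) sequentially"
        using s0 s by (auto simp: filterlim_at intro!: always_eventually less_imp_neq[THEN not_sym])
      ultimately show "(\<lambda>n. D n x) \<longlonglongrightarrow> G x \<bullet> e"
        unfolding D_def by (subst inner_commute) (rule filterlim_compose)
    qed
    show "AE x in lborel. norm (D n x) \<le> indicator (cball 0 (r + norm e)) x *\<^sub>R (C * norm e)" for n
    proof (rule AE_I2)
      fix x
      show "norm (D n x) \<le> indicator (cball 0 (r + norm e)) x *\<^sub>R (C * norm e)"
      proof (cases "x \<in> cball 0 (r + norm e)")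
        case True
        have "\<bar>F (x + s n *\<^sub>R e) - F x\<bar> \<le> s n * (C * norm e)"
          using lip[of "x + s n *\<^sub>R e" x] s[of n] by (simp add: mult.left_commute)
        then show ?thesis using True s[of n] by (simp add: D_def pos_divide_le_eq mult.commute)
      next
        case False
        have se: "norm (s n *\<^sub>R e) \<le> norm e"
          using s[of n] by (simp add: mult_left_le_one_le)
        have "x \<notin> S"
        proof
          assume "x \<in> S"
          then have "norm x \<le> r" using r by auto
          then show False using False norm_ge_zero[of e] by simp
        qed
        moreover have "x + s n *\<^sub>R e \<notin> S"
        proof
          assume "x + s n *\<^sub>R e \<in> S"
          then have "norm (x + s n *\<^sub>R e) \<le> r" using r by auto
          then show False using False se norm_triangle_ineq4[of "x + s n *\<^sub>R e" "s n *\<^sub>R e"] by simp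
        qed
        ultimately show ?thesis by (simp add: D_def F0 C0)
      qed
    qed
    show "D n \<in> borel_measurable lborel" for n unfolding D_def by measurable
  qed measurable
  then show ?thesis by (simp add: D_zero LIMSEQ_const_iff)
qed

lemma smooth_grad:
  assumes "smooth f"
  shows "GDERIV f x :> grad f x" and "continuous_on UNIV (grad f)"
proof -
  have "Ck (Suc 0) f" using assms unfolding smooth_def by blast
  then obtain g where g: "\<And>x. GDERIV f x :> g x" "\<And>i. continuous_on UNIV (\<lambda>x. g x $ i)"
    by auto
  have "grad f x = g x" for x
    using frechet_derivative_at[OF g(1)[unfolded gderiv_def, of x], symmetric]
    by (simp add: grad_def vec_eq_iff inner_axis')
  then have "grad f = g" by auto
  moreover have "continuous_on UNIV (\<lambda>x. \<chi> i. g x $ i)"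
    using g(2) by (rule continuous_on_vec_lambda)
  ultimately show "GDERIV f x :> grad f x" "continuous_on UNIV (grad f)"
    using g(1) by simp_all
qed

lemma grad_eq_0_outside_support:
  assumes "x \<notin> closure {x. f x \<noteq> 0}"
  shows "grad f x = 0"
proof -
  have "((\<lambda>_. 0) has_derivative (\<lambda>_. 0)) (at x)" by simp
  then have "(f has_derivative (\<lambda>_. 0)) (at x)"
    by (rule has_derivative_transform_within_open[of _ _ _ _ "- closure {x. f x \<noteq> 0}"])
      (use assms closure_subset[of "{x. f x \<noteq> 0}"] in auto)
  then show ?thesis
    by (simp add: grad_def frechet_derivative_at[symmetric] vec_eq_iff)
qed

lemma test_function_props:
  assumes "test_function U \<phi>"
  shows "continuous_on UNIV \<phi>" "continuous_on UNIV (grad \<phi>)"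
    "x \<notin> U \<Longrightarrow> \<phi> x = 0" "x \<notin> U \<Longrightarrow> grad \<phi> x = 0" "smooth \<phi>"
proof -
  let ?S = "closure {x. \<phi> x \<noteq> 0}"
  have *: "smooth \<phi>" "?S \<subseteq> U" using assms by (auto simp: test_function_def)
  then show "smooth \<phi>" "continuous_on UNIV (grad \<phi>)" "continuous_on UNIV \<phi>"
    by (auto intro: smooth_grad) (meson Ck_continuous smooth_def)
  show "x \<notin> U \<Longrightarrow> \<phi> x = 0" using * closure_subset[of "{x. \<phi> x \<noteq> 0}"] by blast
  show "grad \<phi> x = 0" if "x \<notin> U"
    using grad_eq_0_outside_support[of x \<phi>] that * by blast
qed


text \<open>The product has the compact support of \<open>\<phi>\<close>, so each of its partial derivatives integrates to 0.\<close>

lemma integration_by_parts: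
  assumes \<phi>: "test_function U \<phi>" and \<psi>: "smooth \<psi>"
  shows "(LINT x|lborel. \<psi> x * grad \<phi> x $ i) = - (LINT x|lborel. \<phi> x * grad \<psi> x $ i)"
proof -
  let ?S = "closure {x. \<phi> x \<noteq> 0}"
  have S: "compact ?S" using \<phi> by (simp add: test_function_def)
  have outside: "\<phi> x = 0" "grad \<phi> x = 0" if "x \<notin> ?S" for x
    using that closure_subset[of "{x. \<phi> x \<noteq> 0}"] grad_eq_0_outside_support by blast+
  have s\<phi>: "smooth \<phi>" using \<phi> by (simp add: test_function_def)
  have cont: "continuous_on UNIV \<phi>" "continuous_on UNIV \<psi>" "continuous_on UNIV (grad \<phi>)" "continuous_on UNIV (grad \<psi>)"
    using s\<phi> \<psi> by (blast intro: smooth_grad GDERIV_continuous_on)+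
  have int: "integrable lborel f" if "continuous_on UNIV f" "\<And>x. x \<notin> ?S \<Longrightarrow> f x = 0" for f :: "real^'a \<Rightarrow> real"
  proof -
    have "integrable lborel (\<lambda>x. indicator ?S x *\<^sub>R f x)"
      using borel_integrable_compact[OF S continuous_on_subset[OF that(1)]] by auto
    also have "(\<lambda>x. indicator ?S x *\<^sub>R f x) = f" using that(2) by (fastforce simp: indicator_def)
    finally show ?thesis .
  qed
  have "(LINT x|lborel. (\<phi> x *\<^sub>R grad \<psi> x + \<psi> x *\<^sub>R grad \<phi> x) \<bullet> axis i 1) = 0"
  proof (rule integral_directional_derivative_eq_0[OF _ _ S])
    show "GDERIV (\<lambda>x. \<phi> x * \<psi> x) x :> \<phi> x *\<^sub>R grad \<psi> x + \<psi> x *\<^sub>R grad \<phi> x" for x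
      by (intro GDERIV_mult smooth_grad s\<phi> \<psi>)
    show "continuous_on UNIV (\<lambda>x. \<phi> x *\<^sub>R grad \<psi> x + \<psi> x *\<^sub>R grad \<phi> x)"
      by (intro continuous_on_add continuous_on_scaleR cont)
  qed (frule outside(1), drule outside(2), simp)+
  moreover have i1: "integrable lborel (\<lambda>x. \<phi> x * grad \<psi> x $ i)"
  proof (rule int)
    show "continuous_on UNIV (\<lambda>x. \<phi> x * grad \<psi> x $ i)"
      by (intro continuous_on_mult continuous_on_component cont)
  qed (frule outside(1), drule outside(2), simp)
  moreover have i2: "integrable lborel (\<lambda>x. \<psi> x * grad \<phi> x $ i)"
  proof (rule int)
    show "continuous_on UNIV (\<lambda>x. \<psi> x * grad \<phi> x $ i)"
      by (intro continuous_on_mult continuous_on_component cont)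
  qed (frule outside(1), drule outside(2), simp)
  ultimately show ?thesis
    by (simp add: inner_axis inner_add_left)
qed


section \<open>Square roots of positive definite matrices\<close>

lemma spd_inner_commute:
  assumes "spd M"
  shows "x \<bullet> (M *v y) = (M *v x) \<bullet> y"
  using assms dot_lmul_matrix[of x M y] by (metis spd_def transpose_matrix_vector)

lemma spd_nonneg: "spd M \<Longrightarrow> 0 \<le> x \<bullet> (M *v x)"
  by (cases "x = 0") (auto simp: spd_def less_imp_le)

lemma spd_coercive:
  fixes M :: "real^'d^'d"
  assumes "spd M"
  obtains m where "m > 0" "\<And>x. m * (norm x)\<^sup>2 \<le> x \<bullet> (M *v x)"
proof -
  have "continuous_on (sphere 0 1) (\<lambda>x. x \<bullet> (M *v x))"
    by (intro continuous_intros matrix_vector_mult_linear_continuous_on)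
  moreover have "sphere (0::real^'d) 1 \<noteq> {}" by simp
  ultimately have "\<exists>z\<in>sphere 0 1. \<forall>y\<in>sphere 0 1. z \<bullet> (M *v z) \<le> y \<bullet> (M *v y)"
    by (intro continuous_attains_inf compact_sphere)
  then obtain z where z: "z \<in> sphere 0 1" "\<forall>y\<in>sphere 0 1. z \<bullet> (M *v z) \<le> y \<bullet> (M *v y)"
    by (rule bexE)
  have "z \<noteq> 0" using z(1) by auto
  then have "z \<bullet> (M *v z) > 0" using assms by (auto simp: spd_def)
  moreover have "z \<bullet> (M *v z) * (norm x)\<^sup>2 \<le> x \<bullet> (M *v x)" for x
  proof (cases "x = 0")
    case False
    let ?y = "(1 / norm x) *\<^sub>R x"
    have "z \<bullet> (M *v z) \<le> ?y \<bullet> (M *v ?y)"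
      using z(2)[rule_format, of ?y] False by simp
    also have "\<dots> = (x \<bullet> (M *v x)) / (norm x)\<^sup>2"
      by (simp add: matrix_vector_mult_scaleR power2_eq_square)
    finally show ?thesis
      using False by (simp add: pos_le_divide_eq)
  qed simp
  ultimately show ?thesis using that by blast
qed

text \<open>After rescaling, \<open>M = 1 - R\<close> with \<open>R\<close> of norm below 1, and \<open>1 - Y\<close> is a square root of
  \<open>M\<close> iff \<open>Y = (R + Y\<^sup>2) / 2\<close>, which is a contraction on a ball of radius below 1.\<close>

lemma spd_square_root_exists:
  fixes M :: "real^'d^'d"
  assumes M: "spd M"
  shows "\<exists>B. spd B \<and> B ** B = M"
proof -
  obtain m where m: "m > 0" "\<And>x. m * (norm x)\<^sup>2 \<le> x \<bullet> (M *v x)"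
    using spd_coercive[OF M] by metis
  define T where "T = Blinfun ((*v) M)"
  have T: "blinfun_apply T x = M *v x" for x
    unfolding T_def by (simp add: bounded_linear_Blinfun_apply)
  define L where "L = norm T + m"
  have L: "L > 0" "m \<le> L" using m by (auto simp: L_def add_nonneg_pos)
  \<comment> \<open>the minimizer of the bound \<open>1 - 2 t m + t\<^sup>2 L\<^sup>2\<close> for the squared norm of \<open>1 - t M\<close>\<close>
  define t where "t = m / L\<^sup>2"
  have t: "t > 0" using m L by (simp add: t_def)
  define q where "q = 1 - (m / L)\<^sup>2"
  have "(m / L)\<^sup>2 \<le> 1\<^sup>2" using m L by (intro power_mono) auto
  then have q: "0 \<le> q" "q < 1" using m L by (auto simp: q_def)
  define r where "r = sqrt q"
  have r: "0 \<le> r" "r < 1" "r\<^sup>2 = q" using q by (auto simp: r_def real_sqrt_lt_1_iff)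
  define R where "R = id_blinfun - t *\<^sub>R T"
  have Rx: "blinfun_apply R x = x - t *\<^sub>R (M *v x)" for x
    by (simp add: R_def T blinfun.diff_left blinfun.scaleR_left)
  have normR: "norm R \<le> r"
  proof (rule norm_blinfun_bound[OF r(1)])
    fix x
    have "norm (M *v x) \<le> norm T * norm x" using norm_blinfun[of T x] by (simp add: T)
    also have "\<dots> \<le> L * norm x" using m by (simp add: L_def mult_right_mono)
    finally have "(norm (M *v x))\<^sup>2 \<le> (L * norm x)\<^sup>2" by (simp add: power_mono)
    then have "t\<^sup>2 * (norm (M *v x))\<^sup>2 \<le> t\<^sup>2 * (L * norm x)\<^sup>2" by (simp add: mult_left_mono)
    moreover have "t * (m * (norm x)\<^sup>2) \<le> t * (x \<bullet> (M *v x))"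
      using m t by (intro mult_left_mono) auto
    moreover have "(norm (blinfun_apply R x))\<^sup>2 = (norm x)\<^sup>2 - 2 * (t * (x \<bullet> (M *v x))) + t\<^sup>2 * (norm (M *v x))\<^sup>2"
      unfolding Rx power2_norm_eq_inner
      by (simp add: inner_diff_left inner_diff_right inner_commute power2_eq_square algebra_simps)
    ultimately have "(norm (blinfun_apply R x))\<^sup>2 \<le> (norm x)\<^sup>2 - 2 * (t * (m * (norm x)\<^sup>2)) + t\<^sup>2 * (L * norm x)\<^sup>2"
      by linarith
    also have "\<dots> = q * (norm x)\<^sup>2"
      using L by (simp add: q_def t_def power2_eq_square field_simps)
    also have "\<dots> = (r * norm x)\<^sup>2" by (simp add: power_mult_distrib r)
    finally show "norm (blinfun_apply R x) \<le> r * norm x"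
      by (rule power2_le_imp_le) (use r in simp)
  qed
  define S where "S = {Y :: (real^'d) \<Rightarrow>\<^sub>L (real^'d). norm Y \<le> r \<and> (\<forall>x y. x \<bullet> blinfun_apply Y y = blinfun_apply Y x \<bullet> y)}"
  have Rsym: "x \<bullet> blinfun_apply R y = blinfun_apply R x \<bullet> y" for x y
    by (simp add: Rx inner_diff_left inner_diff_right spd_inner_commute[OF M])
  define \<Phi> where "\<Phi> Y = (1/2) *\<^sub>R (R + (Y o\<^sub>L Y))" for Y
  have "\<exists>!Y\<in>S. \<Phi> Y = Y"
  proof (rule Banach_fix)
    show "complete S"
    proof -
      have "closed S"
        unfolding S_def
      proof (intro closed_Collect_conj closed_Collect_le closed_Collect_all closed_Collect_eq)
        have "continuous_on UNIV (\<lambda>Y :: (real^'d) \<Rightarrow>\<^sub>L (real^'d). blinfun_apply Y x)" for x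
          by (rule bounded_linear.continuous_on[OF blinfun.bounded_linear_left]) (rule continuous_on_id)
        then show "continuous_on UNIV (\<lambda>Y :: (real^'d) \<Rightarrow>\<^sub>L (real^'d). x \<bullet> blinfun_apply Y y)"
          "continuous_on UNIV (\<lambda>Y :: (real^'d) \<Rightarrow>\<^sub>L (real^'d). blinfun_apply Y x \<bullet> y)" for x y
          by (intro continuous_on_inner continuous_on_const; assumption)+
      qed (intro continuous_on_norm continuous_on_id continuous_on_const)+
      then show ?thesis by (simp add: complete_eq_closed)
    qed
    have "0 \<in> S" using r by (simp add: S_def)
    then show "S \<noteq> {}" by blast
    show "0 \<le> r" "r < 1" by (fact r)+
    show "\<Phi> ` S \<subseteq> S"
    proof clarify
      fix Y assume Y: "Y \<in> S"
      have "norm (Y o\<^sub>L Y) \<le> norm Y * norm Y" by (rule norm_blinfun_compose)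
      also have "\<dots> \<le> r * 1" using Y r by (intro mult_mono) (auto simp: S_def)
      finally have "norm (R + (Y o\<^sub>L Y)) \<le> r + r" using normR norm_triangle_ineq[of R "Y o\<^sub>L Y"] by linarith
      then have "norm (\<Phi> Y) \<le> r" by (simp add: \<Phi>_def)
      moreover have "x \<bullet> blinfun_apply (\<Phi> Y) y = blinfun_apply (\<Phi> Y) x \<bullet> y" for x y
      proof -
        have "x \<bullet> blinfun_apply Y (blinfun_apply Y y) = blinfun_apply Y (blinfun_apply Y x) \<bullet> y"
          using Y by (simp add: S_def)
        then show ?thesis
          by (simp add: \<Phi>_def blinfun.add_left blinfun.scaleR_left inner_add_left inner_add_right Rsym)
      qed
      ultimately show "\<Phi> Y \<in> S" by (simp add: S_def)
    qed
    show "dist (\<Phi> Y) (\<Phi> Z) \<le> r * dist Y Z" if "Y \<in> S" "Z \<in> S" for Y Z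
    proof -
      have "\<Phi> Y - \<Phi> Z = (1/2) *\<^sub>R ((Y o\<^sub>L (Y - Z)) + ((Y - Z) o\<^sub>L Z))"
        by (rule blinfun_eqI) (simp add: \<Phi>_def blinfun.bilinear_simps algebra_simps)
      then have "norm (\<Phi> Y - \<Phi> Z) \<le> (1/2) * (norm (Y o\<^sub>L (Y - Z)) + norm ((Y - Z) o\<^sub>L Z))"
        by (simp add: norm_triangle_ineq)
      also have "\<dots> \<le> (1/2) * (norm Y * norm (Y - Z) + norm (Y - Z) * norm Z)"
        by (intro mult_left_mono add_mono norm_blinfun_compose) auto
      also have "\<dots> \<le> (1/2) * (r * norm (Y - Z) + norm (Y - Z) * r)"
        using that by (intro mult_left_mono add_mono mult_right_mono) (auto simp: S_def)
      finally show ?thesis by (simp add: dist_norm)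
    qed
  qed
  then obtain Y where Y: "Y \<in> S" "\<Phi> Y = Y" by blast
  have YY: "blinfun_apply Y (blinfun_apply Y x) = 2 *\<^sub>R blinfun_apply Y x - blinfun_apply R x" for x
  proof -
    have "2 *\<^sub>R blinfun_apply Y x = 2 *\<^sub>R blinfun_apply (\<Phi> Y) x" using Y by simp
    also have "\<dots> = blinfun_apply R x + blinfun_apply Y (blinfun_apply Y x)"
      by (simp add: \<Phi>_def blinfun.bilinear_simps)
    finally show ?thesis by simp
  qed
  define Z where "Z = (1 / sqrt t) *\<^sub>R (id_blinfun - Y)"
  define B where "B = matrix (blinfun_apply Z)"
  have "linear (blinfun_apply Z)" by (rule blinfun.bounded_linear_right[THEN bounded_linear.linear])
  then have "B *v x = blinfun_apply Z x" for x
    unfolding B_def by (intro matrix_works) (simp add: linear_matrix_vector_mul_eq)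
  then have Bx: "B *v x = (1 / sqrt t) *\<^sub>R (x - blinfun_apply Y x)" for x
    by (simp add: Z_def blinfun.diff_left blinfun.scaleR_left)
  have "B ** B = M"
  proof (subst matrix_eq, intro allI)
    fix x
    have "B *v (B *v x) = (1 / sqrt t * (1 / sqrt t)) *\<^sub>R (x - blinfun_apply R x)"
      by (simp add: Bx blinfun.bilinear_simps YY algebra_simps scaleR_2)
    also have "\<dots> = M *v x" using t by (simp add: Rx)
    finally show "(B ** B) *v x = M *v x" by (simp add: matrix_vector_mul_assoc)
  qed
  moreover have "spd B"
    unfolding spd_def
  proof (intro conjI allI impI)
    have sym: "x \<bullet> (B *v y) = (B *v x) \<bullet> y" for x y
      using Y(1) by (simp add: S_def Bx inner_diff_left inner_diff_right)
    have "axis i 1 \<bullet> (B *v axis j 1) = (B *v axis i 1) \<bullet> axis j 1" for i j by (rule sym)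
    then show "transpose B = B"
      by (simp add: vec_eq_iff transpose_def inner_axis inner_axis' matrix_vector_mult_basis column_def)
    fix x :: "real^'d" assume x: "x \<noteq> 0"
    have "x \<bullet> blinfun_apply Y x \<le> norm x * (norm Y * norm x)"
      using norm_cauchy_schwarz[of x "blinfun_apply Y x"]
        mult_left_mono[OF norm_blinfun[of Y x] norm_ge_zero[of x]] by linarith
    also have "\<dots> \<le> norm x * (r * norm x)"
      using Y(1) by (intro mult_left_mono mult_right_mono) (auto simp: S_def)
    also have "\<dots> < norm x * (1 * norm x)"
      using x r by (intro mult_strict_left_mono mult_strict_right_mono) auto
    finally have "x \<bullet> blinfun_apply Y x < x \<bullet> x" by (simp add: dot_square_norm power2_eq_square)
    then show "x \<bullet> (B *v x) > 0"
      using t by (simp add: Bx inner_diff_right)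
  qed
  ultimately show ?thesis by blast
qed

text \<open>For \<open>D = B - C\<close> and \<open>S = B + C\<close>, the anticommutator \<open>D S + S D = 2 (B\<^sup>2 - C\<^sup>2)\<close> vanishes,
  hence so does the trace of \<open>D S D\<close>.  This trace is the sum of the values of the positive definite form \<open>S\<close> at
  the columns of \<open>D\<close>.\<close>

lemma spd_square_root_unique:
  fixes B C :: "real^'d^'d"
  assumes B: "spd B" and C: "spd C" and eq: "B ** B = C ** C"
  shows "B = C"
proof -
  define D where "D = B - C"
  define S where "S = B + C"
  have S: "spd S"
    using B C unfolding S_def spd_def
    by (auto simp: transpose_def vec_eq_iff matrix_vector_mult_add_rdistrib inner_add_right add_pos_pos)
  have symD: "x \<bullet> (D *v y) = (D *v x) \<bullet> y" for x y
    by (simp add: D_def matrix_vector_mult_diff_rdistrib inner_diff_left inner_diff_right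
        spd_inner_commute[OF B] spd_inner_commute[OF C])
  have "S ** D + D ** S = 0"
  proof (subst matrix_eq, intro allI)
    fix x
    have "B *v (B *v x) = C *v (C *v x)" using eq by (simp add: matrix_vector_mul_assoc)
    then show "(S ** D + D ** S) *v x = 0 *v x"
      by (simp add: S_def D_def algebra_simps flip: matrix_vector_mul_assoc)
  qed
  then have anti: "S ** D = - (D ** S)" by (simp add: eq_neg_iff_add_eq_0)
  have "trace (D ** (S ** D)) = - trace (D ** (D ** S))"
    unfolding anti by (simp add: trace_def matrix_matrix_mult_def sum_negf)
  also have "trace (D ** (D ** S)) = trace (D ** S ** D)"
    by (rule trace_mul_sym)
  finally have "trace (D ** (S ** D)) = 0"
    by (simp add: matrix_mul_assoc)
  moreover have "trace (D ** (S ** D)) = (\<Sum>i\<in>UNIV. (D *v axis i 1) \<bullet> (S *v (D *v axis i 1)))"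
  proof -
    have "(D ** (S ** D)) $ i $ i = axis i 1 \<bullet> (D *v (S *v (D *v axis i 1)))" for i
      by (simp only: matrix_vector_mul_assoc) (simp add: inner_axis' matrix_vector_mult_basis column_def)
    then show ?thesis by (simp add: trace_def symD)
  qed
  ultimately have "\<forall>i\<in>UNIV. (D *v axis i 1) \<bullet> (S *v (D *v axis i 1)) = 0"
    by (subst sum_nonneg_eq_0_iff[symmetric]) (auto intro: spd_nonneg[OF S])
  then have "D *v axis i 1 = 0" for i
    using S unfolding spd_def by (metis UNIV_I less_irrefl)
  then have "D = 0"
    by (simp add: matrix_vector_mult_basis column_def vec_eq_iff)
  then show ?thesis by (simp add: D_def)
qed

lemma mat_sqrt:
  assumes "spd M"
  shows "spd (mat_sqrt M)" "mat_sqrt M ** mat_sqrt M = M"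
proof -
  have "\<exists>!B. spd B \<and> B ** B = M"
    using spd_square_root_exists[OF assms] spd_square_root_unique by metis
  then have "spd (mat_sqrt M) \<and> mat_sqrt M ** mat_sqrt M = M"
    unfolding mat_sqrt_def by (rule theI')
  then show "spd (mat_sqrt M)" "mat_sqrt M ** mat_sqrt M = M" by auto
qed

lemma spd_matrix_inv:
  assumes "spd B"
  shows "B *v (matrix_inv B *v x) = x"
proof -
  have "\<forall>x. B *v x = 0 \<longrightarrow> x = 0" using assms by (auto simp: spd_def)
  then have "invertible B"
    using matrix_left_invertible_ker invertible_left_inverse by blast
  then have "B ** matrix_inv B = mat 1"
    unfolding matrix_inv_def invertible_def by (rule someI2_ex) simp
  then show ?thesis by (simp add: matrix_vector_mul_assoc)
qed

text \<open>Let \<open>B\<close> be the square root of \<open>M\<close>, \<open>F = B (a - p)\<close>, \<open>E = B (a - c)\<close> and \<open>H = B\<^sup>-\<^sup>1 \<tau> + B p\<close>.  Then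
  \<open>B (c - p) = F - E\<close>, and completing the square gives
  \<open>F\<^sup>2 + (H + E)\<^sup>2 = H\<^sup>2 + (F - E)\<^sup>2 + 2 (F + H) E\<close>.  The sum \<open>F + H = B a + B\<^sup>-\<^sup>1 \<tau>\<close> is free of \<open>p\<close>, and since \<open>B\<close> is
  symmetric its product with \<open>E\<close> contains only \<open>M = B\<^sup>2\<close>.  That product is the term which will integrate
  to 0.\<close>

lemma pointwise_estimate:
  assumes M: "spd M"
  shows "(norm (mat_sqrt M *v (a - p)))\<^sup>2 \<le>
    (norm (mat_inv_sqrt M *v \<tau> + mat_sqrt M *v p))\<^sup>2 + (norm (mat_sqrt M *v (c - p)))\<^sup>2
      + 2 * ((M *v a + \<tau>) \<bullet> (a - c))"
proof -
  let ?B = "mat_sqrt M"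
  note B = mat_sqrt[OF M]
  define F where "F = ?B *v (a - p)"
  define E where "E = ?B *v (a - c)"
  define H where "H = mat_inv_sqrt M *v \<tau> + ?B *v p"
  have "(norm (?B *v (c - p)))\<^sup>2 = (norm (F - E))\<^sup>2"
    by (simp add: F_def E_def matrix_vector_mult_diff_distrib)
  moreover have "(M *v a + \<tau>) \<bullet> (a - c) = (F + H) \<bullet> E"
  proof -
    have "F + H = ?B *v a + mat_inv_sqrt M *v \<tau>"
      by (simp add: F_def H_def matrix_vector_mult_diff_distrib)
    then have "(F + H) \<bullet> E = (?B *v (?B *v a + mat_inv_sqrt M *v \<tau>)) \<bullet> (a - c)"
      by (simp add: E_def spd_inner_commute[OF B(1)])
    also have "?B *v (?B *v a + mat_inv_sqrt M *v \<tau>) = M *v a + \<tau>"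
      by (simp add: matrix_vector_right_distrib spd_matrix_inv[OF B(1)])
        (simp add: matrix_vector_mul_assoc B(2))
    finally show ?thesis by simp
  qed
  moreover have "(norm F)\<^sup>2 + (norm (H + E))\<^sup>2 = (norm H)\<^sup>2 + (norm (F - E))\<^sup>2 + 2 * ((F + H) \<bullet> E)"
    by (simp add: power2_norm_eq_inner inner_add_left inner_add_right inner_diff_left
        inner_diff_right inner_commute)
  ultimately show ?thesis
    using zero_le_power2[of "norm (H + E)"] unfolding F_def H_def by linarith
qed


section \<open>Square integrable functions\<close>

lemma L2_D: "F \<in> L2 M \<Longrightarrow> F \<in> borel_measurable M" "F \<in> L2 M \<Longrightarrow> integrable M (\<lambda>x. (norm (F x))\<^sup>2)"
  by (auto simp: L2_def)

lemma L2_dominated: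
  assumes G: "G \<in> L2 M" and F: "F \<in> borel_measurable M"
    and bound: "AE x in M. norm (F x) \<le> C * norm (G x)"
  shows "F \<in> L2 M"
proof -
  have "integrable M (\<lambda>x. C\<^sup>2 * (norm (G x))\<^sup>2)" using L2_D[OF G] by simp
  then have "integrable M (\<lambda>x. (norm (F x))\<^sup>2)"
  proof (rule Bochner_Integration.integrable_bound)
    show "(\<lambda>x. (norm (F x))\<^sup>2) \<in> borel_measurable M" using F by measurable
    show "AE x in M. norm ((norm (F x))\<^sup>2) \<le> norm (C\<^sup>2 * (norm (G x))\<^sup>2)"
      using bound
    proof eventually_elim
      case (elim x)
      then have "(norm (F x))\<^sup>2 \<le> (C * norm (G x))\<^sup>2" by (intro power_mono) auto
      then show ?case by (simp add: power_mult_distrib)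
    qed
  qed
  with F show ?thesis by (simp add: L2_def)
qed

lemma product_le_sum_of_squares: "x * y \<le> x\<^sup>2 + (y::real)\<^sup>2"
proof -
  have "0 \<le> (x - y)\<^sup>2 + x\<^sup>2 + y\<^sup>2" by simp
  then show ?thesis by (simp add: power2_diff)
qed

lemma L2_product_integrable:
  fixes h :: "'a \<Rightarrow> 'b::{banach, second_countable_topology}"
  assumes F: "F \<in> L2 M" and G: "G \<in> L2 M" and h: "h \<in> borel_measurable M"
    and bound: "\<And>x. norm (h x) \<le> norm (F x) * norm (G x)"
  shows "integrable M h"
proof (rule Bochner_Integration.integrable_bound)
  show "integrable M (\<lambda>x. (norm (F x))\<^sup>2 + (norm (G x))\<^sup>2)"
    using L2_D[OF F] L2_D[OF G] by simp
  have "norm (h x) \<le> (norm (F x))\<^sup>2 + (norm (G x))\<^sup>2" for x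
    using bound[of x] product_le_sum_of_squares[of "norm (F x)" "norm (G x)"] by linarith
  then show "AE x in M. norm (h x) \<le> norm ((norm (F x))\<^sup>2 + (norm (G x))\<^sup>2)" by simp
qed (fact h)

lemma L2_inner_integrable:
  fixes F G :: "'a \<Rightarrow> 'b::euclidean_space"
  assumes "F \<in> L2 M" "G \<in> L2 M"
  shows "integrable M (\<lambda>x. F x \<bullet> G x)"
  using assms by (rule L2_product_integrable)
    (use assms[THEN L2_D(1)] in \<open>auto intro: Cauchy_Schwarz_ineq2\<close>)

lemma L2_scaleR_integrable:
  fixes G :: "'a \<Rightarrow> 'b::euclidean_space"
  assumes "F \<in> L2 M" "G \<in> L2 M"
  shows "integrable M (\<lambda>x. F x *\<^sub>R G x)"
  using assms by (rule L2_product_integrable) (use assms[THEN L2_D(1)] in auto)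

lemma L2_add:
  fixes F G :: "'a \<Rightarrow> 'b::euclidean_space"
  assumes F: "F \<in> L2 M" and G: "G \<in> L2 M"
  shows "(\<lambda>x. F x + G x) \<in> L2 M"
proof -
  have "integrable M (\<lambda>x. (norm (F x))\<^sup>2 + (norm (G x))\<^sup>2 + 2 * (F x \<bullet> G x))"
    using L2_D[OF F] L2_D[OF G] L2_inner_integrable[OF F G] by simp
  then show ?thesis
    using L2_D(1)[OF F] L2_D(1)[OF G]
    by (simp add: L2_def power2_norm_eq_inner inner_add_left inner_add_right inner_commute algebra_simps)
qed

lemma L2_minus: "F \<in> L2 M \<Longrightarrow> (\<lambda>x. - F x :: 'b::euclidean_space) \<in> L2 M"
  by (simp add: L2_def)

lemma L2_diff:
  fixes F G :: "'a \<Rightarrow> 'b::euclidean_space"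
  shows "F \<in> L2 M \<Longrightarrow> G \<in> L2 M \<Longrightarrow> (\<lambda>x. F x - G x) \<in> L2 M"
  using L2_add[of F M "\<lambda>x. - G x"] L2_minus[of G M] by simp

lemma L2_zero: "(\<lambda>_. 0) \<in> L2 M"
  by (simp add: L2_def)

lemma L2_sum:
  fixes F :: "'i \<Rightarrow> 'a \<Rightarrow> 'b::euclidean_space"
  shows "(\<And>i. i \<in> I \<Longrightarrow> F i \<in> L2 M) \<Longrightarrow> (\<lambda>x. \<Sum>i\<in>I. F i x) \<in> L2 M"
  by (induction I rule: infinite_finite_induct) (auto intro: L2_zero L2_add)

lemma L2_lebesgue_on_iff:
  fixes F :: "'a::euclidean_space \<Rightarrow> 'b::euclidean_space"
  assumes "U \<in> sets lebesgue"
  shows "F \<in> L2 (lebesgue_on U) \<longleftrightarrow> (\<lambda>x. indicat_real U x *\<^sub>R F x) \<in> L2 lebesgue"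
proof -
  have *: "(\<lambda>x. (norm (indicat_real U x *\<^sub>R F x))\<^sup>2) = (\<lambda>x. indicat_real U x *\<^sub>R (norm (F x))\<^sup>2)"
    by (auto simp: indicator_def)
  show ?thesis
    unfolding L2_def mem_Collect_eq * using assms
    by (simp add: integrable_lebesgue_on_iff borel_measurable_restrict_space_iff)
qed

lemma L2_indicator:
  fixes F :: "'a \<Rightarrow> 'b::euclidean_space"
  assumes "F \<in> L2 M" "S \<in> sets M"
  shows "(\<lambda>x. indicat_real S x *\<^sub>R F x) \<in> L2 M"
  by (rule L2_dominated[OF assms(1), of _ 1])
    (use assms L2_D(1)[OF assms(1)] in \<open>auto simp: indicator_def intro!: borel_measurable_scaleR\<close>)

lemma L2_lebesgue_on_subset:
  fixes F :: "'a::euclidean_space \<Rightarrow> 'b::euclidean_space"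
  assumes F: "F \<in> L2 (lebesgue_on U)" and U: "U \<in> sets lebesgue" and V: "V \<in> sets lebesgue" "V \<subseteq> U"
  shows "F \<in> L2 (lebesgue_on V)"
proof -
  have "(\<lambda>x. indicat_real V x *\<^sub>R (indicat_real U x *\<^sub>R F x)) \<in> L2 lebesgue"
    using F U V L2_indicator[of "\<lambda>x. indicat_real U x *\<^sub>R F x" lebesgue V]
    by (simp add: L2_lebesgue_on_iff)
  also have "(\<lambda>x. indicat_real V x *\<^sub>R (indicat_real U x *\<^sub>R F x)) = (\<lambda>x. indicat_real V x *\<^sub>R F x)"
    using V by (fastforce simp: indicator_def)
  finally show ?thesis using V by (simp add: L2_lebesgue_on_iff)
qed

lemma L2_extend_by_zero:
  fixes F :: "'a::euclidean_space \<Rightarrow> 'b::euclidean_space"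
  assumes F: "F \<in> L2 (lebesgue_on V)" and U: "U \<in> sets lebesgue" and V: "V \<in> sets lebesgue"
  shows "(\<lambda>x. indicat_real V x *\<^sub>R F x) \<in> L2 (lebesgue_on U)"
  using F U V L2_indicator[of "\<lambda>x. indicat_real V x *\<^sub>R F x" lebesgue U]
  by (simp add: L2_lebesgue_on_iff)

lemma L2_bounded_set_integrable:
  fixes F :: "'a::euclidean_space \<Rightarrow> 'b::euclidean_space"
  assumes F: "F \<in> L2 (lebesgue_on U)" and U: "open U" "bounded U"
  shows "integrable (lebesgue_on U) F"
proof -
  interpret finite_measure "lebesgue_on U"
    using U by (intro finite_measure_lebesgue_on) (simp add: lmeasurable_open)
  have "(\<lambda>_. 1::real) \<in> L2 (lebesgue_on U)" by (simp add: L2_def)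
  from L2_scaleR_integrable[OF this F] show ?thesis by simp
qed

lemma norm_L2_squared: "(norm_L2 M F)\<^sup>2 = (LINT x|M. (norm (F x))\<^sup>2)"
  by (simp add: norm_L2_def integral_nonneg_AE)

lemma inner_L2_cong_AE:
  fixes F G :: "'a \<Rightarrow> 'b::euclidean_space"
  assumes "F \<in> L2 M" "F' \<in> L2 M" "G \<in> L2 M" "G' \<in> L2 M"
    and "AE x in M. F x = F' x" "AE x in M. G x = G' x"
  shows "inner_L2 M F G = inner_L2 M F' G'"
  unfolding inner_L2_def
proof (rule integral_cong_AE)
  show "AE x in M. F x \<bullet> G x = F' x \<bullet> G' x" using assms(5,6) by eventually_elim simp
qed (use assms(1-4)[THEN L2_D(1)] in auto)

lemma inner_L2_add_left:
  fixes F G :: "'a \<Rightarrow> 'b::euclidean_space"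
  assumes "F \<in> L2 M" "F' \<in> L2 M" "G \<in> L2 M"
  shows "inner_L2 M (\<lambda>x. F x + F' x) G = inner_L2 M F G + inner_L2 M F' G"
  using L2_inner_integrable[OF assms(1,3)] L2_inner_integrable[OF assms(2,3)]
  by (simp add: inner_L2_def inner_add_left)

lemma inner_L2_diff_right:
  fixes F G :: "'a \<Rightarrow> 'b::euclidean_space"
  assumes "F \<in> L2 M" "G \<in> L2 M" "G' \<in> L2 M"
  shows "inner_L2 M F (\<lambda>x. G x - G' x) = inner_L2 M F G - inner_L2 M F G'"
  using L2_inner_integrable[OF assms(1,2)] L2_inner_integrable[OF assms(1,3)]
  by (simp add: inner_L2_def inner_diff_right)

lemma inner_L2_minus_left: "inner_L2 M (\<lambda>x. - F x) G = - inner_L2 M F G"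
  by (simp add: inner_L2_def)

lemma continuous_compact_support_L2:
  fixes F :: "'a::euclidean_space \<Rightarrow> 'b::euclidean_space"
  assumes F: "continuous_on UNIV F" and S: "compact S" and F0: "\<And>x. x \<notin> S \<Longrightarrow> F x = 0"
    and U: "U \<in> sets lebesgue"
  shows "F \<in> L2 (lebesgue_on U)"
proof -
  have F_meas: "F \<in> borel_measurable borel" using F by (rule borel_measurable_continuous_onI)
  have "continuous_on S (\<lambda>x. (norm (F x))\<^sup>2)"
    by (intro continuous_on_power continuous_on_norm continuous_on_subset[OF F]) simp
  then have "integrable lborel (\<lambda>x. indicator S x *\<^sub>R (norm (F x))\<^sup>2)"
    by (rule borel_integrable_compact[OF S])
  also have "(\<lambda>x. indicator S x *\<^sub>R (norm (F x))\<^sup>2) = (\<lambda>x. (norm (F x))\<^sup>2)"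
    using F0 by (fastforce simp: indicator_def)
  finally have "integrable lebesgue (\<lambda>x. (norm (F x))\<^sup>2)"
    by (subst integrable_completion) (use F_meas in auto)
  then have "F \<in> L2 lebesgue"
    using F_meas by (simp add: L2_def measurable_completion)
  then show ?thesis using U by (simp add: L2_lebesgue_on_iff L2_indicator)
qed

lemma test_function_L2:
  assumes "test_function V \<phi>" and "U \<in> sets lebesgue"
  shows "\<phi> \<in> L2 (lebesgue_on U)" "grad \<phi> \<in> L2 (lebesgue_on U)"
proof -
  have S: "compact (closure {x. \<phi> x \<noteq> 0})" using assms by (simp add: test_function_def)
  show "\<phi> \<in> L2 (lebesgue_on U)"
    by (rule continuous_compact_support_L2[OF test_function_props(1)[OF assms(1)] S _ assms(2)])
      (use closure_subset[of "{x. \<phi> x \<noteq> 0}"] in blast)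
  show "grad \<phi> \<in> L2 (lebesgue_on U)"
    by (rule continuous_compact_support_L2[OF test_function_props(2)[OF assms(1)] S _ assms(2)])
      (rule grad_eq_0_outside_support)
qed

lemma integral_lebesgue_on_subset:
  fixes F :: "'a::euclidean_space \<Rightarrow> 'b::{banach, second_countable_topology}"
  assumes "U \<in> sets lebesgue" "V \<in> sets lebesgue" "V \<subseteq> U" "\<And>x. x \<notin> V \<Longrightarrow> F x = 0"
  shows "(LINT x|lebesgue_on U. F x) = (LINT x|lebesgue_on V. F x)"
proof -
  have "(\<lambda>x. indicat_real U x *\<^sub>R F x) = (\<lambda>x. indicat_real V x *\<^sub>R F x)"
    using assms by (fastforce simp: indicator_def)
  then show ?thesis using assms by (simp add: integral_lebesgue_on)
qed


section \<open>Weak gradients and divergences\<close>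

lemma is_weak_grad_unique:
  fixes U :: "(real^'d) set"
  assumes U: "open U" "bounded U" and G: "is_weak_grad U v G" and G': "is_weak_grad U v G'"
  shows "AE x in lebesgue_on U. G x = G' x"
proof -
  have Us: "U \<in> sets lebesgue" using U by auto
  have L: "G \<in> L2 (lebesgue_on U)" "G' \<in> L2 (lebesgue_on U)" using G G' by (auto simp: is_weak_grad_def)
  have "AE x in lebesgue_on U. (G x - G' x) $ i = 0" for i
  proof (rule fundamental_lemma_variations[OF U(1)])
    have "integrable (lebesgue_on U) (\<lambda>x. G x - G' x)"
      using L U by (intro L2_bounded_set_integrable L2_diff)
    then show "integrable (lebesgue_on U) (\<lambda>x. (G x - G' x) $ i)"
      by (rule integrable_bounded_linear[OF bounded_linear_vec_nth])
    fix \<phi> assume \<phi>: "test_function U \<phi>"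
    note \<phi>L = test_function_L2(1)[OF \<phi> Us]
    have eq: "(LINT x|lebesgue_on U. \<phi> x *\<^sub>R G x) = (LINT x|lebesgue_on U. \<phi> x *\<^sub>R G' x)"
      using G G' \<phi> by (simp add: is_weak_grad_def)
    have "(LINT x|lebesgue_on U. \<phi> x * (G x - G' x) $ i) = (LINT x|lebesgue_on U. (\<phi> x *\<^sub>R G x - \<phi> x *\<^sub>R G' x) $ i)"
      by (simp add: algebra_simps)
    also have "\<dots> = (LINT x|lebesgue_on U. \<phi> x *\<^sub>R G x - \<phi> x *\<^sub>R G' x) $ i"
      by (intro integral_bounded_linear bounded_linear_vec_nth Bochner_Integration.integrable_diff
          L2_scaleR_integrable \<phi>L L)
    also have "\<dots> = 0"
      using L2_scaleR_integrable[OF \<phi>L L(1)] L2_scaleR_integrable[OF \<phi>L L(2)] eq by simp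
    finally show "(LINT x|lebesgue_on U. \<phi> x * (G x - G' x) $ i) = 0" .
  qed
  then have "AE x in lebesgue_on U. \<forall>i\<in>UNIV. (G x - G' x) $ i = 0"
    by (intro AE_finite_allI) auto
  then show ?thesis
    by eventually_elim (simp add: vec_eq_iff)
qed

lemma is_weak_div_unique:
  fixes U :: "(real^'d) set"
  assumes U: "open U" "bounded U" and q: "is_weak_div U \<tau> q" and q': "is_weak_div U \<tau> q'"
  shows "AE x in lebesgue_on U. q x = q' x"
proof -
  have Us: "U \<in> sets lebesgue" using U by auto
  have L: "q \<in> L2 (lebesgue_on U)" "q' \<in> L2 (lebesgue_on U)" using q q' by (auto simp: is_weak_div_def)
  have "AE x in lebesgue_on U. q x - q' x = 0"
  proof (rule fundamental_lemma_variations[OF U(1)])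
    show "integrable (lebesgue_on U) (\<lambda>x. q x - q' x)"
      using L U by (intro L2_bounded_set_integrable L2_diff)
    fix \<phi> assume \<phi>: "test_function U \<phi>"
    have "inner_L2 (lebesgue_on U) \<phi> (\<lambda>x. q x - q' x) = inner_L2 (lebesgue_on U) \<phi> q - inner_L2 (lebesgue_on U) \<phi> q'"
      by (intro inner_L2_diff_right L test_function_L2[OF \<phi> Us])
    also have "\<dots> = 0"
      using q q' \<phi> by (simp add: is_weak_div_def inner_L2_def mult.commute)
    finally show "(LINT x|lebesgue_on U. \<phi> x * (q x - q' x)) = 0"
      by (simp add: inner_L2_def)
  qed
  then show ?thesis by simp
qed

lemma is_weak_grad_weak_grad: "v \<in> H1 U \<Longrightarrow> is_weak_grad U v (weak_grad U v)"
  unfolding H1_def weak_grad_def using someI_ex[of "is_weak_grad U v"] by auto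

lemma weak_grad_L2: "v \<in> H1 U \<Longrightarrow> weak_grad U v \<in> L2 (lebesgue_on U)"
  using is_weak_grad_weak_grad by (auto simp: is_weak_grad_def)

lemma is_weak_div_weak_div: "\<tau> \<in> Hdiv U \<Longrightarrow> is_weak_div U \<tau> (weak_div U \<tau>)"
  unfolding Hdiv_def weak_div_def using someI_ex[of "is_weak_div U \<tau>"] by auto

lemma is_weak_grad_diff:
  fixes U :: "(real^'d) set"
  assumes U: "open U" and v: "v \<in> L2 (lebesgue_on U)" "is_weak_grad U v G"
    and w: "w \<in> L2 (lebesgue_on U)" "is_weak_grad U w H"
  shows "is_weak_grad U (\<lambda>x. v x - w x) (\<lambda>x. G x - H x)"
  unfolding is_weak_grad_def
proof (intro conjI allI impI)
  have Us: "U \<in> sets lebesgue" using U by auto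
  have L: "G \<in> L2 (lebesgue_on U)" "H \<in> L2 (lebesgue_on U)" using v w by (auto simp: is_weak_grad_def)
  then show "(\<lambda>x. G x - H x) \<in> L2 (lebesgue_on U)" by (rule L2_diff)
  fix \<phi> assume \<phi>: "test_function U \<phi>"
  note \<phi>L = test_function_L2[OF \<phi> Us]
  show "(LINT x|lebesgue_on U. (v x - w x) *\<^sub>R grad \<phi> x) = - (LINT x|lebesgue_on U. \<phi> x *\<^sub>R (G x - H x))"
    using v(2) w(2) \<phi> L2_scaleR_integrable[OF v(1) \<phi>L(2)] L2_scaleR_integrable[OF w(1) \<phi>L(2)]
      L2_scaleR_integrable[OF \<phi>L(1) L(1)] L2_scaleR_integrable[OF \<phi>L(1) L(2)]
    by (simp add: is_weak_grad_def scaleR_diff_left scaleR_diff_right)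
qed

lemma is_weak_grad_subset:
  fixes U :: "(real^'d) set"
  assumes U: "open U" and V: "open V" "V \<subseteq> U" and G: "is_weak_grad U v G"
  shows "is_weak_grad V v G"
  unfolding is_weak_grad_def
proof (intro conjI allI impI)
  have Us: "U \<in> sets lebesgue" "V \<in> sets lebesgue" using U V by auto
  show "G \<in> L2 (lebesgue_on V)"
    using G Us V by (auto simp: is_weak_grad_def intro: L2_lebesgue_on_subset)
  fix \<phi> assume \<phi>: "test_function V \<phi>"
  then have "test_function U \<phi>" using V by (auto simp: test_function_def)
  then have "(LINT x|lebesgue_on U. v x *\<^sub>R grad \<phi> x) = - (LINT x|lebesgue_on U. \<phi> x *\<^sub>R G x)"
    using G by (simp add: is_weak_grad_def)
  moreover have "(LINT x|lebesgue_on U. v x *\<^sub>R grad \<phi> x) = (LINT x|lebesgue_on V. v x *\<^sub>R grad \<phi> x)"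
    by (rule integral_lebesgue_on_subset[OF Us V(2)]) (simp add: test_function_props(4)[OF \<phi>])
  moreover have "(LINT x|lebesgue_on U. \<phi> x *\<^sub>R G x) = (LINT x|lebesgue_on V. \<phi> x *\<^sub>R G x)"
    by (rule integral_lebesgue_on_subset[OF Us V(2)]) (simp add: test_function_props(3)[OF \<phi>])
  ultimately show "(LINT x|lebesgue_on V. v x *\<^sub>R grad \<phi> x) = - (LINT x|lebesgue_on V. \<phi> x *\<^sub>R G x)"
    by simp
qed

text \<open>The classical gradient is a weak one; the test function \<open>\<psi>\<close> carries the compact support, and the
  integrals over \<open>U\<close> extend to the whole space.\<close>

lemma is_weak_grad_test_function:
  fixes U :: "(real^'d) set"
  assumes U: "open U" and \<phi>: "test_function U \<phi>"
  shows "is_weak_grad U \<phi> (grad \<phi>)"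
  unfolding is_weak_grad_def
proof (intro conjI allI impI)
  have Us: "U \<in> sets lebesgue" using U by auto
  note \<phi>L = test_function_L2[OF \<phi> Us]
  show "grad \<phi> \<in> L2 (lebesgue_on U)" by (rule \<phi>L)
  fix \<psi> assume \<psi>: "test_function U \<psi>"
  note \<psi>L = test_function_L2[OF \<psi> Us]
  have comp: "(LINT x|lebesgue_on U. F x *\<^sub>R G x) $ i = (LINT x|lborel. F x * G x $ i)"
    if FG: "F \<in> L2 (lebesgue_on U)" "G \<in> L2 (lebesgue_on U)" "continuous_on UNIV F" "continuous_on UNIV G"
      and 0: "\<And>x. x \<notin> U \<Longrightarrow> F x = 0" for F :: "real^'d \<Rightarrow> real" and G :: "real^'d \<Rightarrow> real^'d" and i
  proof -
    have "(LINT x|lebesgue_on U. F x *\<^sub>R G x) $ i = (LINT x|lebesgue_on U. (F x *\<^sub>R G x) $ i)"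
      by (rule integral_bounded_linear[OF bounded_linear_vec_nth L2_scaleR_integrable[OF FG(1,2)], symmetric])
    also have "\<dots> = (LINT x|lebesgue_on UNIV. (F x *\<^sub>R G x) $ i)"
      by (rule integral_lebesgue_on_subset[symmetric]) (use Us 0 in auto)
    also have "\<dots> = (LINT x|lborel. F x * G x $ i)"
    proof -
      have "(\<lambda>x. F x * G x $ i) \<in> borel_measurable lborel"
        using FG(3,4) by (simp add: borel_measurable_continuous_onI continuous_on_mult continuous_on_component)
      then show ?thesis by (simp add: lebesgue_on_UNIV_eq integral_completion)
    qed
    finally show ?thesis .
  qed
  note p\<phi> = test_function_props[OF \<phi>] and p\<psi> = test_function_props[OF \<psi>]
  have "(LINT x|lebesgue_on U. \<phi> x *\<^sub>R grad \<psi> x) $ i = - (LINT x|lebesgue_on U. \<psi> x *\<^sub>R grad \<phi> x) $ i" for i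
    using integration_by_parts[OF \<psi> p\<phi>(5), of i]
    by (simp add: comp[OF \<phi>L(1) \<psi>L(2) p\<phi>(1) p\<psi>(2) p\<phi>(3)] comp[OF \<psi>L(1) \<phi>L(2) p\<psi>(1) p\<phi>(2) p\<psi>(3)])
  then show "(LINT x|lebesgue_on U. \<phi> x *\<^sub>R grad \<psi> x) = - (LINT x|lebesgue_on U. \<psi> x *\<^sub>R grad \<phi> x)"
    by (simp add: vec_eq_iff)
qed

lemma weak_grad_test_function:
  fixes U :: "(real^'d) set"
  assumes U: "open U" "bounded U" and \<phi>: "test_function U \<phi>"
  shows "\<phi> \<in> H1 U" "AE x in lebesgue_on U. weak_grad U \<phi> x = grad \<phi> x"
proof -
  have Us: "U \<in> sets lebesgue" using U by auto
  show H: "\<phi> \<in> H1 U"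
    using is_weak_grad_test_function[OF U(1) \<phi>] test_function_L2(1)[OF \<phi> Us] by (auto simp: H1_def)
  show "AE x in lebesgue_on U. weak_grad U \<phi> x = grad \<phi> x"
    by (rule is_weak_grad_unique[OF U is_weak_grad_weak_grad[OF H] is_weak_grad_test_function[OF U(1) \<phi>]])
qed

text \<open>The constant sequence \<open>\<phi>\<close> is an admissible approximation, with gradients equal to the weak gradient
  only almost everywhere.\<close>

lemma has_trace_test_function:
  fixes U :: "(real^'d) set"
  assumes U: "open U" "bounded U" and \<phi>: "test_function U \<phi>"
  shows "has_trace U \<phi> (\<lambda>_. 0)"
proof -
  have "\<phi> x = 0" if "x \<in> frontier U" for x
    using that U by (intro test_function_props(3)[OF \<phi>]) (auto simp: frontier_def interior_open)
  moreover have "space (surface_measure U) \<subseteq> frontier U"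
    by (auto simp: surface_measure_def space_restrict_space)
  ultimately have "(\<integral>\<^sup>+x. ennreal ((norm (\<phi> x - 0))\<^sup>2) \<partial>surface_measure U) = (\<integral>\<^sup>+x. 0 \<partial>surface_measure U)"
    by (intro nn_integral_cong) auto
  then have "converges_L2 (surface_measure U) (\<lambda>n::nat. \<phi>) (\<lambda>_. 0)"
    by (simp add: converges_L2_def)
  moreover have "(\<integral>\<^sup>+x. ennreal ((norm (grad \<phi> x - weak_grad U \<phi> x))\<^sup>2) \<partial>lebesgue_on U) = (\<integral>\<^sup>+x. 0 \<partial>lebesgue_on U)"
    using weak_grad_test_function(2)[OF U \<phi>] by (intro nn_integral_cong_AE) (auto elim!: eventually_mono)
  then have "converges_L2 (lebesgue_on U) (\<lambda>n::nat. grad \<phi>) (weak_grad U \<phi>)"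
    by (simp add: converges_L2_def)
  moreover have "converges_L2 (lebesgue_on U) (\<lambda>n::nat. \<phi>) \<phi>"
    by (simp add: converges_L2_def)
  ultimately show ?thesis
    unfolding has_trace_def
    using weak_grad_test_function(1)[OF U \<phi>] test_function_props(5)[OF \<phi>] L2_zero
    by (intro conjI exI[of _ "\<lambda>_. \<phi>"]) auto
qed

lemma H1_zero_on_D: "v \<in> H1_zero_on U \<Gamma> \<Longrightarrow> v \<in> H1 U" "v \<in> H1_zero_on U \<Gamma> \<Longrightarrow> \<exists>\<mu>. has_trace U v \<mu>"
  by (auto simp: H1_zero_on_def)

lemma test_function_H1_zero_on:
  fixes U :: "(real^'d) set"
  assumes U: "open U" "bounded U" and \<phi>: "test_function U \<phi>"
  shows "\<phi> \<in> H1_zero_on U \<Gamma>"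
  using weak_grad_test_function(1)[OF assms] has_trace_test_function[OF assms]
  by (auto simp: H1_zero_on_def)


section \<open>Partitions and broken gradients\<close>

lemma negligible_frontier_polygonal:
  fixes S :: "(real^'d) set"
  assumes "polygonal S"
  shows "negligible (frontier S)"
proof -
  obtain \<F> where \<F>: "finite \<F>" "\<forall>F\<in>\<F>. polytope F \<and> aff_dim F = int CARD('d) - 1" "frontier S = \<Union>\<F>"
    using assms unfolding polygonal_def by blast
  have "negligible F" if "F \<in> \<F>" for F
  proof -
    have "interior F = {}"
      using \<F> that by (intro low_dim_interior) auto
    then show ?thesis
      using \<F> that by (simp add: negligible_convex_interior polytope_imp_convex)
  qed
  then show ?thesis using \<F> by (simp add: negligible_Union)
qed

text \<open>A Lipschitz domain lies locally on one side of its boundary: above a boundary point,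
  in the direction of \<open>e\<close>, there are points outside the closure.\<close>

lemma lipschitz_boundary_interior_closure:
  fixes \<Omega> :: "(real^'d) set"
  assumes "lipschitz_boundary \<Omega>"
  shows "interior (closure \<Omega>) \<subseteq> \<Omega>"
proof
  fix x assume x: "x \<in> interior (closure \<Omega>)"
  show "x \<in> \<Omega>"
  proof (rule ccontr)
    assume xn: "x \<notin> \<Omega>"
    then have "x \<in> frontier \<Omega>"
      using x interior_subset by (auto simp: frontier_def)
    then obtain r e L \<phi> where r: "r > 0" and e: "norm e = 1"
      and lip: "L-lipschitz_on {y. y \<bullet> e = 0} \<phi>"
      and graph: "\<Omega> \<inter> ball x r = {z \<in> ball x r. (z - x) \<bullet> e < (\<phi> ((z - x) - ((z - x) \<bullet> e) *\<^sub>R e) :: real)}"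
      using assms unfolding lipschitz_boundary_def by meson
    define h where "h z = (z - x) \<bullet> e - \<phi> ((z - x) - ((z - x) \<bullet> e) *\<^sub>R e)" for z
    have ee: "e \<bullet> e = 1" using e by (simp add: dot_square_norm)
    have "continuous_on UNIV (\<lambda>z. \<phi> ((z - x) - ((z - x) \<bullet> e) *\<^sub>R e))"
    proof (rule continuous_on_compose2[OF lipschitz_on_continuous_on[OF lip]])
      show "continuous_on UNIV (\<lambda>z. (z - x) - ((z - x) \<bullet> e) *\<^sub>R e)"
        by (intro continuous_intros)
      show "(\<lambda>z. (z - x) - ((z - x) \<bullet> e) *\<^sub>R e) ` UNIV \<subseteq> {y. y \<bullet> e = 0}"
        by (auto simp: inner_diff_left ee)
    qed
    then have h: "continuous_on UNIV h"
      unfolding h_def by (intro continuous_intros)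
    obtain \<epsilon> where \<epsilon>: "\<epsilon> > 0" "ball x \<epsilon> \<subseteq> closure \<Omega>"
      using x by (auto simp: mem_interior)
    define s where "s = min \<epsilon> r / 2"
    have s: "s > 0" "s < \<epsilon>" "s < r" using \<epsilon> r by (auto simp: s_def)
    have "x \<notin> \<Omega> \<inter> ball x r" using xn by simp
    then have "\<phi> 0 \<le> 0" unfolding graph using r by simp
    then have hy: "h (x + s *\<^sub>R e) > 0" using s by (simp add: h_def ee)
    have y: "x + s *\<^sub>R e \<in> closure \<Omega>"
      using \<epsilon> s e by (auto simp: dist_norm)
    have "open ({z. 0 < h z} \<inter> ball x r)"
      by (intro open_Int open_ball open_Collect_less continuous_on_const h)
    then have "({z. 0 < h z} \<inter> ball x r) \<inter> \<Omega> = {} \<longleftrightarrow> ({z. 0 < h z} \<inter> ball x r) \<inter> closure \<Omega> = {}"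
      by (rule open_Int_closure_eq_empty[symmetric])
    moreover have "x + s *\<^sub>R e \<in> ({z. 0 < h z} \<inter> ball x r) \<inter> closure \<Omega>"
      using hy y s e by (auto simp: dist_norm)
    ultimately have "({z. 0 < h z} \<inter> ball x r) \<inter> \<Omega> \<noteq> {}" by blast
    then obtain z where "z \<in> \<Omega>" "0 < h z" "z \<in> ball x r" by auto
    then have "z \<in> \<Omega> \<inter> ball x r" "\<not> (z - x) \<bullet> e < \<phi> ((z - x) - ((z - x) \<bullet> e) *\<^sub>R e)"
      by (auto simp: h_def)
    then show False unfolding graph by simp
  qed
qed

lemma regular_partition_interior_subset:
  assumes "regular_partition \<Omega> \<T>" "lipschitz_boundary \<Omega>" "K \<in> \<T>"
  shows "interior K \<subseteq> \<Omega>"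
proof -
  have "\<Union>\<T> = closure \<Omega>" using assms(1) by (simp add: regular_partition_def)
  then have "K \<subseteq> closure \<Omega>" using assms(3) by auto
  then have "interior K \<subseteq> interior (closure \<Omega>)" by (rule interior_mono)
  also have "\<dots> \<subseteq> \<Omega>" by (rule lipschitz_boundary_interior_closure[OF assms(2)])
  finally show ?thesis .
qed

lemma regular_partition_bounded: "regular_partition \<Omega> \<T> \<Longrightarrow> K \<in> \<T> \<Longrightarrow> bounded (interior K)"
  by (rule bounded_subset[OF polytope_imp_bounded interior_subset]) (simp add: regular_partition_def)

lemma AE_regular_partition:
  fixes \<Omega> :: "(real^'d) set"
  assumes T: "regular_partition \<Omega> \<T>" and U: "\<Omega> \<in> sets lebesgue"
  shows "AE x in lebesgue_on \<Omega>. \<exists>K\<in>\<T>. x \<in> interior K"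
proof -
  have "negligible (\<Union>K\<in>\<T>. frontier K)"
    using T by (intro negligible_Union)
      (auto simp: regular_partition_def intro!: negligible_convex_frontier polytope_imp_convex)
  then have "AE x in lebesgue. x \<notin> (\<Union>K\<in>\<T>. frontier K)"
    by (intro AE_not_in) (simp add: negligible_iff_null_sets)
  then have "AE x in lebesgue. x \<in> \<Omega> \<longrightarrow> (\<exists>K\<in>\<T>. x \<in> interior K)"
  proof eventually_elim
    case (elim x)
    have "\<Omega> \<subseteq> \<Union>\<T>" using T closure_subset[of \<Omega>] by (simp add: regular_partition_def)
    moreover have "x \<in> interior K" if "K \<in> \<T>" "x \<in> K" for K
      using that elim closure_subset[of K] by (auto simp: frontier_def)
    ultimately show ?case by blast
  qed
  then show ?thesis using U by (simp add: AE_restrict_space_iff)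
qed

lemma broken_grad_eq:
  assumes T: "regular_partition \<Omega> \<T>" and K: "K \<in> \<T>" and x: "x \<in> interior K"
  shows "broken_grad \<T> v x = weak_grad (interior K) v x"
proof -
  have "indicat_real (interior L) x = 0" if "L \<in> \<T> - {K}" for L
  proof -
    have "L \<in> \<T>" "K \<noteq> L" using that by auto
    then have "interior K \<inter> interior L = {}" using T K by (simp add: regular_partition_def)
    then show ?thesis using x by (auto simp: indicator_def)
  qed
  then have "(\<Sum>L\<in>\<T> - {K}. indicat_real (interior L) x *\<^sub>R weak_grad (interior L) v x) = 0"
    by (intro sum.neutral) simp
  moreover have "finite \<T>" using T by (simp add: regular_partition_def)
  ultimately show ?thesis
    using x by (simp only: broken_grad_def sum.remove[OF _ K]) simp
qed

lemma broken_H1_D: "v \<in> broken_H1 \<Omega> \<T> \<Longrightarrow> K \<in> \<T> \<Longrightarrow> v \<in> H1 (interior K)"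
  by (simp add: broken_H1_def)

lemma broken_grad_L2:
  fixes \<Omega> :: "(real^'d) set"
  assumes v: "v \<in> broken_H1 \<Omega> \<T>" and U: "\<Omega> \<in> sets lebesgue"
  shows "broken_grad \<T> v \<in> L2 (lebesgue_on \<Omega>)"
  unfolding broken_grad_def[abs_def]
  using v U by (intro L2_sum L2_extend_by_zero weak_grad_L2) (auto simp: broken_H1_def)

text \<open>The broken gradient is assembled from separate choices of weak gradients on the elements and
  on \<open>\<Omega>\<close>.  They are compatible because weak gradients restrict to open subsets and are unique up to
  null sets.\<close>

lemma broken_grad_diff:
  fixes \<Omega> :: "(real^'d) set"
  assumes T: "regular_partition \<Omega> \<T>" and lip: "lipschitz_boundary \<Omega>" and U: "open \<Omega>"
    and v: "v \<in> H1 \<Omega>" and w: "w \<in> broken_H1 \<Omega> \<T>"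
  shows "(\<lambda>x. v x - w x) \<in> broken_H1 \<Omega> \<T>"
    and "AE x in lebesgue_on \<Omega>. broken_grad \<T> (\<lambda>x. v x - w x) x = weak_grad \<Omega> v x - broken_grad \<T> w x"
proof -
  have Us: "\<Omega> \<in> sets lebesgue" using U by auto
  have vL: "v \<in> L2 (lebesgue_on \<Omega>)" using v by (simp add: H1_def)
  have wL: "w \<in> L2 (lebesgue_on \<Omega>)" using w by (simp add: broken_H1_def)
  have diff: "(\<lambda>x. v x - w x) \<in> H1 (interior K)"
    "is_weak_grad (interior K) (\<lambda>x. v x - w x) (\<lambda>x. weak_grad \<Omega> v x - weak_grad (interior K) w x)"
    if K: "K \<in> \<T>" for K
  proof -
    have K\<Omega>: "interior K \<subseteq> \<Omega>" by (rule regular_partition_interior_subset[OF T lip K])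
    have L: "v \<in> L2 (lebesgue_on (interior K))" "w \<in> L2 (lebesgue_on (interior K))"
      using L2_lebesgue_on_subset[OF vL Us _ K\<Omega>] L2_lebesgue_on_subset[OF wL Us _ K\<Omega>] by auto
    show wg: "is_weak_grad (interior K) (\<lambda>x. v x - w x) (\<lambda>x. weak_grad \<Omega> v x - weak_grad (interior K) w x)"
      by (intro is_weak_grad_diff L open_interior is_weak_grad_weak_grad broken_H1_D[OF w K]
          is_weak_grad_subset[OF U open_interior K\<Omega> is_weak_grad_weak_grad[OF v]])
    show "(\<lambda>x. v x - w x) \<in> H1 (interior K)"
      using wg L2_diff[OF L] by (auto simp: H1_def)
  qed
  show "(\<lambda>x. v x - w x) \<in> broken_H1 \<Omega> \<T>"
    using diff(1) L2_diff[OF vL wL] by (simp add: broken_H1_def)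
  have "AE x in lebesgue. x \<in> interior K \<longrightarrow>
      weak_grad (interior K) (\<lambda>x. v x - w x) x = weak_grad \<Omega> v x - weak_grad (interior K) w x"
    if K: "K \<in> \<T>" for K
    using is_weak_grad_unique[OF open_interior regular_partition_bounded[OF T K]
        is_weak_grad_weak_grad[OF diff(1)[OF K]] diff(2)[OF K]]
    by (simp add: AE_restrict_space_iff)
  then have "AE x in lebesgue. \<forall>K\<in>\<T>. x \<in> interior K \<longrightarrow>
      weak_grad (interior K) (\<lambda>x. v x - w x) x = weak_grad \<Omega> v x - weak_grad (interior K) w x"
    using T by (intro AE_finite_allI) (auto simp: regular_partition_def)
  moreover have "AE x in lebesgue. x \<in> \<Omega> \<longrightarrow> (\<exists>K\<in>\<T>. x \<in> interior K)"
    using AE_regular_partition[OF T Us] Us by (simp add: AE_restrict_space_iff)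
  ultimately have "AE x in lebesgue. x \<in> \<Omega> \<longrightarrow>
      broken_grad \<T> (\<lambda>x. v x - w x) x = weak_grad \<Omega> v x - broken_grad \<T> w x"
    by eventually_elim (auto simp: broken_grad_eq[OF T])
  then show "AE x in lebesgue_on \<Omega>. broken_grad \<T> (\<lambda>x. v x - w x) x = weak_grad \<Omega> v x - broken_grad \<T> w x"
    using Us by (simp add: AE_restrict_space_iff)
qed


section \<open>Piecewise constant tensors\<close>

lemma AE_piecewise_constant:
  fixes \<Omega> :: "(real^'d) set"
  assumes A: "piecewise_constant_spd \<Omega> n \<Omega>s A" and U: "\<Omega> \<in> sets lebesgue"
  shows "AE x in lebesgue_on \<Omega>. \<exists>i\<in>{1..n}. x \<in> \<Omega>s i"
proof -
  have poly: "polygonal (\<Omega>s i)" if "i \<in> {1..n}" for i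
    using A that by (simp add: piecewise_constant_spd_def)
  have "negligible (\<Union>i\<in>{1..n}. frontier (\<Omega>s i))"
    using poly by (intro negligible_Union) (auto intro!: negligible_frontier_polygonal)
  then have "AE x in lebesgue. x \<notin> (\<Union>i\<in>{1..n}. frontier (\<Omega>s i))"
    by (intro AE_not_in) (simp add: negligible_iff_null_sets)
  then have "AE x in lebesgue. x \<in> \<Omega> \<longrightarrow> (\<exists>i\<in>{1..n}. x \<in> \<Omega>s i)"
  proof eventually_elim
    case (elim x)
    have "\<Omega> \<subseteq> (\<Union>i\<in>{1..n}. closure (\<Omega>s i))"
      using A closure_subset[of \<Omega>] by (simp add: piecewise_constant_spd_def)
    moreover have "x \<in> \<Omega>s i" if "i \<in> {1..n}" "x \<in> closure (\<Omega>s i)" for i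
      using that elim interior_subset[of "\<Omega>s i"] by (auto simp: frontier_def)
    ultimately show ?case by blast
  qed
  then show ?thesis using U by (simp add: AE_restrict_space_iff)
qed

lemma AE_spd:
  fixes \<Omega> :: "(real^'d) set"
  assumes A: "piecewise_constant_spd \<Omega> n \<Omega>s A" and U: "\<Omega> \<in> sets lebesgue"
  shows "AE x in lebesgue_on \<Omega>. spd (A x)"
  using AE_piecewise_constant[OF A U]
proof eventually_elim
  case (elim x)
  then show ?case using A unfolding piecewise_constant_spd_def by metis
qed

text \<open>The values of \<open>A\<close> on the interfaces may be arbitrary; there measurability comes from
  the completeness of Lebesgue measure.  The function \<open>h\<close>
  stands for the identity, the square root or its inverse.\<close>

lemma L2_piecewise_constant_mult:
  fixes \<Omega> :: "(real^'d) set" and h :: "real^'d^'d \<Rightarrow> real^'d^'d"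
  assumes A: "piecewise_constant_spd \<Omega> n \<Omega>s A" and U: "\<Omega> \<in> sets lebesgue"
    and F: "F \<in> L2 (lebesgue_on \<Omega>)"
  shows "(\<lambda>x. h (A x) *v F x) \<in> L2 (lebesgue_on \<Omega>)"
proof -
  have "\<forall>i\<in>{1..n}. \<exists>M. \<forall>x\<in>\<Omega>s i. A x = M"
    using A unfolding piecewise_constant_spd_def by metis
  then obtain M where M: "\<And>i x. i \<in> {1..n} \<Longrightarrow> x \<in> \<Omega>s i \<Longrightarrow> A x = M i"
    by metis
  have op: "open (\<Omega>s i)" if "i \<in> {1..n}" for i
    using A that by (simp add: piecewise_constant_spd_def polygonal_def)
  define N where "N = \<Omega> - (\<Union>i\<in>{1..n}. \<Omega>s i)"
  have N_sets: "N \<in> sets lebesgue" using U op by (auto simp: N_def)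
  have N: "N \<in> null_sets lebesgue"
  proof -
    have "AE x in lebesgue. x \<notin> N"
      using AE_piecewise_constant[OF A U] U by (auto simp: AE_restrict_space_iff N_def elim!: eventually_mono)
    then show ?thesis using N_sets AE_iff_null_sets by blast
  qed
  have F_meas: "F \<in> borel_measurable (lebesgue_on \<Omega>)" using F by (rule L2_D)
  have meas: "(\<lambda>x. h (A x) *v F x) \<in> borel_measurable (lebesgue_on \<Omega>)"
  proof (rule measurable_piecewise_restrict[of "insert N (\<Omega>s ` {1..n})"])
    show "countable (insert N (\<Omega>s ` {1..n}))" by simp
    show "space (lebesgue_on \<Omega>) \<subseteq> \<Union>(insert N (\<Omega>s ` {1..n}))" by (auto simp: N_def)
    show "X \<inter> space (lebesgue_on \<Omega>) \<in> sets (lebesgue_on \<Omega>)" if "X \<in> insert N (\<Omega>s ` {1..n})" for X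
    proof -
      have "X \<in> sets lebesgue" using that N_sets op by auto
      then show ?thesis using U by (auto simp: sets_restrict_space)
    qed
    show "(\<lambda>x. h (A x) *v F x) \<in> borel_measurable (restrict_space (lebesgue_on \<Omega>) X)"
      if "X \<in> insert N (\<Omega>s ` {1..n})" for X
      using that
    proof
      assume X: "X = N"
      show ?thesis
      proof (rule measurableI)
        fix B
        let ?P = "(\<lambda>x. h (A x) *v F x) -` B \<inter> space (restrict_space (lebesgue_on \<Omega>) X)"
        have sub: "?P \<subseteq> N" using X by (auto simp: space_restrict_space)
        have "?P \<in> sets lebesgue"
          using null_sets_completion_subset[OF sub N] by auto
        moreover have "?P \<subseteq> \<Omega>" "N \<subseteq> \<Omega>" using sub by (auto simp: N_def)
        ultimately show "?P \<in> sets (restrict_space (lebesgue_on \<Omega>) X)"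
          using X sub by (auto simp: restrict_restrict_space sets_restrict_space U N_sets image_iff Int_absorb1
              intro!: bexI[of _ ?P])
      qed simp
    next
      assume "X \<in> \<Omega>s ` {1..n}"
      then obtain i where i: "i \<in> {1..n}" "X = \<Omega>s i" by blast
      have "(\<lambda>x. h (M i) *v F x) \<in> borel_measurable (restrict_space (lebesgue_on \<Omega>) X)"
        by (rule measurable_compose[OF measurable_restrict_space1[OF F_meas]])
          (intro borel_measurable_continuous_onI matrix_vector_mult_linear_continuous_on)
      then show ?thesis
        by (subst measurable_cong[where g = "\<lambda>x. h (M i) *v F x"])
          (auto simp: space_restrict_space i(2) M[OF i(1)])
    qed
  qed
  define C where "C = (\<Sum>i\<in>{1..n}. onorm ((*v) (h (M i))))"
  have "AE x in lebesgue_on \<Omega>. norm (h (A x) *v F x) \<le> C * norm (F x)"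
    using AE_piecewise_constant[OF A U]
  proof eventually_elim
    case (elim x)
    then obtain i where i: "i \<in> {1..n}" "x \<in> \<Omega>s i" by blast
    have "norm (h (A x) *v F x) \<le> onorm ((*v) (h (M i))) * norm (F x)"
      using M[OF i] onorm[of "(*v) (h (M i))" "F x"] by simp
    also have "onorm ((*v) (h (M i))) \<le> C"
      unfolding C_def by (rule member_le_sum) (use i in \<open>auto intro: onorm_pos_le\<close>)
    finally show ?case by (simp add: mult_right_mono)
  qed
  with F meas show ?thesis by (rule L2_dominated)
qed


section \<open>The estimate\<close>

lemma H_minus_half_zero:
  assumes g: "g \<in> H_minus_half \<Omega> \<Gamma>" and tr: "has_trace \<Omega> v (\<lambda>_. 0)"
  shows "g (\<lambda>_. 0) = 0"
proof -
  have "has_trace_on \<Omega> \<Gamma> v (\<lambda>_. 0)" using tr unfolding has_trace_on_def by auto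
  then have zero: "(\<lambda>_. 0) \<in> H_half \<Omega> \<Gamma>" by (auto simp: H_half_def)
  have "\<forall>\<mu>\<in>H_half \<Omega> \<Gamma>. \<forall>c. g (\<lambda>x. c * \<mu> x) = c * g \<mu>"
    using g by (simp add: H_minus_half_def)
  from spec[OF bspec[OF this zero], of 0] show ?thesis by simp
qed

text \<open>This makes the infimum over the fluxes one over a nonempty set; an infimum over the empty
  set of reals would carry no information.  Interior test functions have trace 0, so the weak form
  tested with them says that the divergence is \<open>f\<close>.  With this
  divergence, the weak form for general \<open>v\<close> is Green's formula with normal trace \<open>g\<close>.\<close>

lemma solution_flux_equilibrated:
  fixes \<Omega> :: "(real^'d) set"
  assumes U: "open \<Omega>" "bounded \<Omega>" and A: "piecewise_constant_spd \<Omega> n \<Omega>s A"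
    and f: "f \<in> L2 (lebesgue_on \<Omega>)" and g: "g \<in> H_minus_half \<Omega> \<Gamma>N"
    and u: "weak_solution \<Omega> \<Gamma>D A f g u"
  shows "(\<lambda>x. - (A x *v weak_grad \<Omega> u x)) \<in> equilibrated_fluxes \<Omega> \<Gamma>D f g"
proof -
  let ?L = "lebesgue_on \<Omega>" and ?\<sigma> = "\<lambda>x. A x *v weak_grad \<Omega> u x"
  have Us: "\<Omega> \<in> sets lebesgue" using U by auto
  have uH: "u \<in> H1 \<Omega>" using u by (auto simp: weak_solution_def H1_zero_on_D)
  have weak: "inner_L2 ?L ?\<sigma> (weak_grad \<Omega> v) = inner_L2 ?L f v - g \<mu>"
    if "v \<in> H1_zero_on \<Omega> \<Gamma>D" "has_trace \<Omega> v \<mu>" for v \<mu>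
    using u that by (simp add: weak_solution_def)
  have \<sigma>: "?\<sigma> \<in> L2 ?L"
    using L2_piecewise_constant_mult[OF A Us weak_grad_L2[OF uH], of id] by simp
  then have \<sigma>': "(\<lambda>x. - ?\<sigma> x) \<in> L2 ?L" by (rule L2_minus)
  have div: "is_weak_div \<Omega> (\<lambda>x. - ?\<sigma> x) f"
    unfolding is_weak_div_def
  proof (intro conjI allI impI)
    show "f \<in> L2 ?L" by (rule f)
    fix \<phi> assume \<phi>: "test_function \<Omega> \<phi>"
    note tr = has_trace_test_function[OF U \<phi>]
    have "inner_L2 ?L ?\<sigma> (grad \<phi>) = inner_L2 ?L ?\<sigma> (weak_grad \<Omega> \<phi>)"
      using weak_grad_test_function[OF U \<phi>] test_function_L2[OF \<phi> Us] \<sigma>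
      by (intro inner_L2_cong_AE weak_grad_L2) (auto elim!: eventually_mono)
    also have "\<dots> = inner_L2 ?L f \<phi>"
      using weak[OF test_function_H1_zero_on[OF U \<phi>] tr] H_minus_half_zero[OF g tr] by simp
    finally show "inner_L2 ?L (\<lambda>x. - ?\<sigma> x) (grad \<phi>) = - inner_L2 ?L f \<phi>"
      by (simp add: inner_L2_minus_left)
  qed
  then have Hdiv: "(\<lambda>x. - ?\<sigma> x) \<in> Hdiv \<Omega>" using \<sigma>' by (auto simp: Hdiv_def)
  note wd = is_weak_div_weak_div[OF Hdiv]
  have AEf: "AE x in ?L. weak_div \<Omega> (\<lambda>x. - ?\<sigma> x) x = f x"
    by (rule is_weak_div_unique[OF U wd div])
  moreover have "normal_trace_eq_on \<Omega> \<Gamma>D (\<lambda>x. - ?\<sigma> x) g"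
    unfolding normal_trace_eq_on_def
  proof (intro ballI allI impI)
    fix v \<mu> assume v: "v \<in> H1_zero_on \<Omega> \<Gamma>D" "has_trace \<Omega> v \<mu>"
    have "inner_L2 ?L (weak_div \<Omega> (\<lambda>x. - ?\<sigma> x)) v = inner_L2 ?L f v"
      using wd f AEf H1_zero_on_D(1)[OF v(1)]
      by (intro inner_L2_cong_AE) (auto simp: is_weak_div_def H1_def)
    then show "normal_trace \<Omega> (\<lambda>x. - ?\<sigma> x) v = g \<mu>"
      using weak[OF v] by (simp add: normal_trace_def inner_L2_minus_left)
  qed
  ultimately show ?thesis using Hdiv by (simp add: equilibrated_fluxes_def)
qed

text \<open>The fluxes \<open>\<tau>\<close> and \<open>- A \<nabla>u\<close> have the same divergence and the same Neumann data, so their difference is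
  orthogonal to the gradients of functions that vanish on the Dirichlet part.\<close>

lemma flux_difference_orthogonal:
  fixes \<Omega> :: "(real^'d) set"
  assumes U: "open \<Omega>" and A: "piecewise_constant_spd \<Omega> n \<Omega>s A"
    and f: "f \<in> L2 (lebesgue_on \<Omega>)"
    and u: "weak_solution \<Omega> \<Gamma>D A f g u" and \<tau>: "\<tau> \<in> equilibrated_fluxes \<Omega> \<Gamma>D f g"
    and v: "v \<in> H1_zero_on \<Omega> \<Gamma>D"
  shows "inner_L2 (lebesgue_on \<Omega>) (\<lambda>x. A x *v weak_grad \<Omega> u x + \<tau> x) (weak_grad \<Omega> v) = 0"
proof -
  let ?L = "lebesgue_on \<Omega>" and ?\<sigma> = "\<lambda>x. A x *v weak_grad \<Omega> u x"
  have Us: "\<Omega> \<in> sets lebesgue" using U by auto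
  have uH: "u \<in> H1 \<Omega>" using u by (auto simp: weak_solution_def H1_zero_on_D)
  obtain \<mu> where \<mu>: "has_trace \<Omega> v \<mu>" using H1_zero_on_D(2)[OF v] by blast
  have \<tau>': "\<tau> \<in> Hdiv \<Omega>" "AE x in ?L. weak_div \<Omega> \<tau> x = f x" "normal_trace \<Omega> \<tau> v = g \<mu>"
    using \<tau> v \<mu> by (auto simp: equilibrated_fluxes_def normal_trace_eq_on_def)
  have "inner_L2 ?L (weak_div \<Omega> \<tau>) v = inner_L2 ?L f v"
    using is_weak_div_weak_div[OF \<tau>'(1)] f \<tau>'(2) H1_zero_on_D(1)[OF v]
    by (intro inner_L2_cong_AE) (auto simp: is_weak_div_def H1_def)
  then have "inner_L2 ?L \<tau> (weak_grad \<Omega> v) + inner_L2 ?L f v = g \<mu>"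
    using \<tau>'(3) by (simp add: normal_trace_def)
  moreover have "inner_L2 ?L ?\<sigma> (weak_grad \<Omega> v) = inner_L2 ?L f v - g \<mu>"
    using u v \<mu> by (simp add: weak_solution_def)
  moreover have "?\<sigma> \<in> L2 ?L"
    using L2_piecewise_constant_mult[OF A Us weak_grad_L2[OF uH], of id] by simp
  then have "inner_L2 ?L (\<lambda>x. ?\<sigma> x + \<tau> x) (weak_grad \<Omega> v)
      = inner_L2 ?L ?\<sigma> (weak_grad \<Omega> v) + inner_L2 ?L \<tau> (weak_grad \<Omega> v)"
    using \<tau>'(1) weak_grad_L2[OF H1_zero_on_D(1)[OF v]]
    by (intro inner_L2_add_left) (auto simp: Hdiv_def)
  ultimately show ?thesis by simp
qed

text \<open>The pointwise estimate is integrated.  Its last term pairs \<open>A \<nabla>u + \<tau>\<close> with \<open>\<nabla>u - \<nabla>v\<close>; that field is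
  orthogonal to each of the two gradients.\<close>

lemma error_estimate:
  fixes \<Omega> :: "(real^'d) set"
  assumes U: "open \<Omega>" and lip: "lipschitz_boundary \<Omega>"
    and f: "f \<in> L2 (lebesgue_on \<Omega>)" and A: "piecewise_constant_spd \<Omega> n \<Omega>s A"
    and T: "regular_partition \<Omega> \<T>"
    and u: "weak_solution \<Omega> \<Gamma>D A f g u" and w: "w \<in> broken_H1 \<Omega> \<T>"
    and \<tau>: "\<tau> \<in> equilibrated_fluxes \<Omega> \<Gamma>D f g" and v: "v \<in> H1_zero_on \<Omega> \<Gamma>D"
  shows "(norm_L2 (lebesgue_on \<Omega>) (\<lambda>x. mat_sqrt (A x) *v broken_grad \<T> (\<lambda>y. u y - w y) x))\<^sup>2
    \<le> (norm_L2 (lebesgue_on \<Omega>)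
          (\<lambda>x. mat_inv_sqrt (A x) *v \<tau> x + mat_sqrt (A x) *v broken_grad \<T> w x))\<^sup>2
      + (norm_L2 (lebesgue_on \<Omega>) (\<lambda>x. mat_sqrt (A x) *v broken_grad \<T> (\<lambda>y. v y - w y) x))\<^sup>2"
proof -
  let ?L = "lebesgue_on \<Omega>" and ?p = "broken_grad \<T> w"
    and ?gu = "weak_grad \<Omega> u" and ?gv = "weak_grad \<Omega> v"
  have Us: "\<Omega> \<in> sets lebesgue" using U by auto
  have u0: "u \<in> H1_zero_on \<Omega> \<Gamma>D" using u by (simp add: weak_solution_def)
  note H = H1_zero_on_D(1)[OF u0] H1_zero_on_D(1)[OF v]
  note gL = weak_grad_L2[OF H(1)] weak_grad_L2[OF H(2)]
  note du = broken_grad_diff[OF T lip U H(1) w] and dv = broken_grad_diff[OF T lip U H(2) w]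
  have \<tau>L: "\<tau> \<in> L2 ?L" using \<tau> by (simp add: equilibrated_fluxes_def Hdiv_def)
  note mult = L2_piecewise_constant_mult[OF A Us]
  define F where "F x = mat_sqrt (A x) *v broken_grad \<T> (\<lambda>y. u y - w y) x" for x
  define G where "G x = mat_sqrt (A x) *v broken_grad \<T> (\<lambda>y. v y - w y) x" for x
  define E where "E x = mat_inv_sqrt (A x) *v \<tau> x + mat_sqrt (A x) *v ?p x" for x
  define R where "R x = (A x *v ?gu x + \<tau> x) \<bullet> (?gu x - ?gv x)" for x
  have FL: "F \<in> L2 ?L" unfolding F_def by (intro mult broken_grad_L2 du Us)
  have GL: "G \<in> L2 ?L" unfolding G_def by (intro mult broken_grad_L2 dv Us)
  have EL: "E \<in> L2 ?L"
    unfolding E_def by (intro L2_add mult[of _ "\<lambda>M. matrix_inv (mat_sqrt M)"] mult[of _ mat_sqrt] broken_grad_L2 w Us \<tau>L)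
  have sL: "(\<lambda>x. A x *v ?gu x + \<tau> x) \<in> L2 ?L"
    using L2_add[OF mult[OF gL(1), of id] \<tau>L] by simp
  have Rint: "integrable ?L R"
    unfolding R_def by (intro L2_inner_integrable sL L2_diff gL)
  have R0: "(LINT x|?L. R x) = 0"
    using inner_L2_diff_right[OF sL gL] flux_difference_orthogonal[OF U A f u \<tau> u0]
      flux_difference_orthogonal[OF U A f u \<tau> v]
    by (simp add: inner_L2_def R_def)
  have "(LINT x|?L. (norm (F x))\<^sup>2) \<le> (LINT x|?L. (norm (E x))\<^sup>2 + (norm (G x))\<^sup>2 + 2 * R x)"
  proof (rule integral_mono_AE)
    show "AE x in ?L. (norm (F x))\<^sup>2 \<le> (norm (E x))\<^sup>2 + (norm (G x))\<^sup>2 + 2 * R x"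
      using AE_spd[OF A Us] du(2) dv(2)
    proof eventually_elim
      case (elim x)
      then show ?case
        using pointwise_estimate[OF elim(1), of "?gu x" "?p x" "\<tau> x" "?gv x"]
        by (simp add: F_def E_def G_def R_def)
    qed
  qed (use FL EL GL Rint in \<open>auto simp: L2_D(2)\<close>)
  also have "\<dots> = (LINT x|?L. (norm (E x))\<^sup>2) + (LINT x|?L. (norm (G x))\<^sup>2)"
    using L2_D(2)[OF EL] L2_D(2)[OF GL] Rint R0 by simp
  finally show ?thesis
    by (simp add: norm_L2_squared F_def E_def G_def)
qed

theorem theorem3p1:
  fixes \<Omega> \<Gamma>D \<Gamma>N :: "(real^'d) set"
    and \<Omega>s :: "nat \<Rightarrow> (real^'d) set"
    and n :: nat
    and A :: "real^'d \<Rightarrow> real^'d^'d"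
    and f u w :: "real^'d \<Rightarrow> real"
    and g :: "(real^'d \<Rightarrow> real) \<Rightarrow> real"
    and \<T> :: "(real^'d) set set"
  assumes "CARD('d) \<in> {2, 3}"
    and "polygonal_domain \<Omega>" and "lipschitz_boundary \<Omega>"
    and "\<Gamma>D \<subseteq> frontier \<Omega>" and "\<Gamma>N \<subseteq> frontier \<Omega>"
    and "frontier \<Omega> = closure \<Gamma>D \<union> closure \<Gamma>N" and "closure \<Gamma>D \<inter> closure \<Gamma>N = {}"
    and "emeasure (surface_measure \<Omega>) \<Gamma>D \<noteq> 0"
    and "f \<in> L2 (lebesgue_on \<Omega>)" and "g \<in> H_minus_half \<Omega> \<Gamma>N"
    and "piecewise_constant_spd \<Omega> n \<Omega>s A"
    and "regular_partition \<Omega> \<T>"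
    and "\<forall>K\<in>\<T>. \<forall>i\<in>{1..n}. \<forall>j\<in>{1..n}. i \<noteq> j \<longrightarrow>
           interior K \<inter> (frontier (\<Omega>s i) \<inter> frontier (\<Omega>s j)) = {}"
    and "weak_solution \<Omega> \<Gamma>D A f g u"
    and "w \<in> broken_H1 \<Omega> \<T>"
  shows "(norm_L2 (lebesgue_on \<Omega>) (\<lambda>x. mat_sqrt (A x) *v broken_grad \<T> (\<lambda>y. u y - w y) x))\<^sup>2
    \<le> (INF \<tau>\<in>equilibrated_fluxes \<Omega> \<Gamma>D f g.
          (norm_L2 (lebesgue_on \<Omega>)
            (\<lambda>x. mat_inv_sqrt (A x) *v \<tau> x + mat_sqrt (A x) *v broken_grad \<T> w x))\<^sup>2)
      + (INF v\<in>H1_zero_on \<Omega> \<Gamma>D.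
          (norm_L2 (lebesgue_on \<Omega>) (\<lambda>x. mat_sqrt (A x) *v broken_grad \<T> (\<lambda>y. v y - w y) x))\<^sup>2)"


proof -
  have U: "open \<Omega>" "bounded \<Omega>"
    using assms(2) by (auto simp: polygonal_domain_def polygonal_def)
  let ?X = "(norm_L2 (lebesgue_on \<Omega>) (\<lambda>x. mat_sqrt (A x) *v broken_grad \<T> (\<lambda>y. u y - w y) x))\<^sup>2"
    and ?S = "\<lambda>\<tau>. (norm_L2 (lebesgue_on \<Omega>)
            (\<lambda>x. mat_inv_sqrt (A x) *v \<tau> x + mat_sqrt (A x) *v broken_grad \<T> w x))\<^sup>2"
    and ?Y = "\<lambda>v. (norm_L2 (lebesgue_on \<Omega>) (\<lambda>x. mat_sqrt (A x) *v broken_grad \<T> (\<lambda>y. v y - w y) x))\<^sup>2"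
  have bound: "?X \<le> ?S \<tau> + ?Y v"
    if "\<tau> \<in> equilibrated_fluxes \<Omega> \<Gamma>D f g" "v \<in> H1_zero_on \<Omega> \<Gamma>D" for \<tau> v
    by (rule error_estimate[OF U(1) assms(3,9,11,12,14,15) that])
  have "?X - ?S \<tau> \<le> (INF v\<in>H1_zero_on \<Omega> \<Gamma>D. ?Y v)"
    if \<tau>: "\<tau> \<in> equilibrated_fluxes \<Omega> \<Gamma>D f g" for \<tau>
  proof (rule cINF_greatest)
    show "H1_zero_on \<Omega> \<Gamma>D \<noteq> {}" using assms(14) by (auto simp: weak_solution_def)
  qed (use bound[OF \<tau>] in \<open>simp add: algebra_simps\<close>)
  then have "?X - (INF v\<in>H1_zero_on \<Omega> \<Gamma>D. ?Y v) \<le> ?S \<tau>"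
    if "\<tau> \<in> equilibrated_fluxes \<Omega> \<Gamma>D f g" for \<tau>
    using that by (simp add: algebra_simps)
  then have "?X - (INF v\<in>H1_zero_on \<Omega> \<Gamma>D. ?Y v) \<le> (INF \<tau>\<in>equilibrated_fluxes \<Omega> \<Gamma>D f g. ?S \<tau>)"
    using solution_flux_equilibrated[OF U assms(11,9,10,14)] by (intro cINF_greatest) auto
  then show ?thesis by simp
qed

end
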